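(* Let $A\in\mathbb{R}^{m\times n}$ with $1\le k\le m\le n$ and $\operatorname{rank}(A)\ge k$. Let $C\in\mathbb{R}^{m\times k}$ consist of the $k$ columns of $A$ selected by the column subset selection algorithm (defined in the context) applied to $A$ and $k$, let $R\in\mathbb{R}^{k\times n}$ consist of the $k$ rows of $A$ whose indices are selected by the same algorithm applied to $A^T$ and $k$, and let $U=C^{+}AR^{+}$. Then $$\| A - CUR \|_F \le \sqrt{2k+2}\,\sqrt{\sigma_{k+1}(A)^2+\cdots+\sigma_m(A)^2}.$$
   Context: $\|\cdot\|_F$ is the Frobenius norm, $(\cdot)^+$ the Moore–Penrose inverse, and $\sigma_1(A)\ge\sigma_2(A)\ge\cdots\ge\sigma_m(A)$ are the singular values of $A$. $M(:,S)$ denotes the submatrix of $M$ formed by the columns with indices in the tuple $S$. For a $p\times q$ real matrix $B$, the coefficients $c_j(BB^T)$, $0\le j\le p$, are defined by $$\det(BB^T-\lambda\,\mathrm{Id}) = (-\lambda)^p + c_{p-1}(-\lambda)^{p-1}+\dots+c_1(-\lambda)+c_0,$$ with $c_p=1$ (so $c_j(BB^T)$ is the elementary symmetric polynomial of degree $p-j$ in the eigenvalues of $BB^T$). Column subset selection algorithm (in exact arithmetic): Input a $p\times q$ real matrix $M$ and an integer $k$ with $1\le k\le \operatorname{rank}(M)$. Set $S=()$ (empty tuple) and $B=M$. For $t=1,\dots,k$: (1) for each $i\in\{1,\dots,q\}$ such that the $i$th column $b_i$ of $B$ is nonzero, let $B_i=\left(\mathrm{Id}-\frac{b_ib_i^T}{\|b_i\|_2^2}\right)B$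 and compute the ratio $$\frac{c_{p-k+t-1}(B_iB_i^T)}{c_{p-k+t}(B_iB_i^T)};$$ (2) let $i_t$ be an index $i$ minimizing this ratio (any minimizer) and append $i_t$ to $S$; (3) set $B = M-M(:,S)M(:,S)^+M$. Return $S=(i_1,\dots,i_k)$, i.e. the selected columns are $M(:,S)$. *)

theory Defs
  imports
    Complex_Main
    "HOL-Computational_Algebra.Polynomial"
    "Jordan_Normal_Form.Char_Poly"
    "Jordan_Normal_Form.DL_Rank"
begin

definition frobenius_norm :: "real mat \<Rightarrow> real" where
  "frobenius_norm A = sqrt (\<Sum>i<dim_row A. \<Sum>j<dim_col A. (A $$ (i, j))\<^sup>2)"

definition is_moore_penrose :: "real mat \<Rightarrow> real mat \<Rightarrow> bool" where
  "is_moore_penrose A X \<longleftrightarrow>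
     X \<in> carrier_mat (dim_col A) (dim_row A) \<and>
     A * X * A = A \<and> X * A * X = X \<and>
     transpose_mat (A * X) = A * X \<and> transpose_mat (X * A) = X * A"

definition moore_penrose :: "real mat \<Rightarrow> real mat" where
  "moore_penrose A = (THE X. is_moore_penrose A X)"

lemma is_moore_penrose_unique:
  assumes "is_moore_penrose A X" "is_moore_penrose A Y"
  shows "X = Y"
proof -
  define m n where "m = dim_row A" and "n = dim_col A"
  have A: "A \<in> carrier_mat m n" by (simp add: m_def n_def)
  have X: "X \<in> carrier_mat n m" and Y: "Y \<in> carrier_mat n m"
    using assms by (auto simp: is_moore_penrose_def m_def n_def)
  have x: "A * X * A = A" "X * A * X = X" "transpose_mat (A * X) = A * X" "transpose_mat (X * A) = X * A"
    and y: "A * Y * A = A" "Y * A * Y = Y" "transpose_mat (A * Y) = A * Y" "transpose_mat (Y * A) = Y * A"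
    using assms by (auto simp: is_moore_penrose_def)
  have AX: "A * X \<in> carrier_mat m m" and AY: "A * Y \<in> carrier_mat m m"
    and XA: "X * A \<in> carrier_mat n n" and YA: "Y * A \<in> carrier_mat n n"
    using A X Y by auto
  have "A * X = A * Y * A * X" by (simp add: y)
  also have "\<dots> = (A * Y) * (A * X)" using AY A X by (rule assoc_mult_mat)
  finally have 1: "A * X = (A * Y) * (A * X)" .
  have "A * X = transpose_mat ((A * Y) * (A * X))" using x 1 by metis
  also have "\<dots> = (A * X) * (A * Y)" using AX AY by (simp add: transpose_mult x y)
  also have "\<dots> = A * X * A * Y" using AX A Y by (rule assoc_mult_mat[symmetric])
  also have "\<dots> = A * Y" by (simp add: x)
  finally have eq1: "A * X = A * Y" .
  have "X * A = X * (A * Y * A)" by (simp add: y)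
  also have "\<dots> = (X * A) * (Y * A)" using A X Y YA by (metis assoc_mult_mat)
  finally have 2: "X * A = (X * A) * (Y * A)" .
  have "X * A = transpose_mat ((X * A) * (Y * A))" using x 2 by metis
  also have "\<dots> = (Y * A) * (X * A)" using XA YA by (simp add: transpose_mult x y)
  also have "\<dots> = Y * (A * X * A)" using A X Y XA by (metis assoc_mult_mat)
  also have "\<dots> = Y * A" by (simp add: x)
  finally have eq2: "X * A = Y * A" .
  have "X = Y * A * X" using x eq2 by metis
  also have "\<dots> = Y * (A * X)" using Y A X by (rule assoc_mult_mat)
  also have "\<dots> = Y * A * Y" using Y A by (simp add: eq1 assoc_mult_mat[OF Y A Y])
  finally show ?thesis by (simp add: y)
qed

text \<open>The list below has length \<open>dim_row A\<close>; this is the convention for singular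
  values of a matrix with at least as many columns as rows.\<close>

definition singular_values :: "real mat \<Rightarrow> real list" where
  "singular_values A =
     rev (sorted_list_of_multiset (image_mset sqrt (proots (char_poly (A * transpose_mat A)))))"

text \<open>Singular values are indexed from 1.\<close>

definition singular_value :: "real mat \<Rightarrow> nat \<Rightarrow> real" where
  "singular_value A i = singular_values A ! (i - 1)"

text \<open>For a square matrix \<open>X\<close> of size \<open>p\<close>, \<open>det_coeff X j\<close> is the coefficient of
  \<open>(-\<lambda>)^j\<close> in \<open>det (X - \<lambda> Id)\<close>: putting \<open>\<mu> = -\<lambda>\<close>, the polynomial
  \<open>det (X + \<mu> Id)\<close> in \<open>\<mu>\<close> is the characteristic polynomial of \<open>-X\<close>.\<close>

definition det_coeff :: "real mat \<Rightarrow> nat \<Rightarrow> real" where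
  "det_coeff X j = coeff (char_poly (- X)) j"

lemma det_coeff:
  assumes X: "X \<in> carrier_mat p p"
  shows "det (X - l \<cdot>\<^sub>m 1\<^sub>m p) = (\<Sum>j\<le>p. det_coeff X j * (- l) ^ j)"
    and "det_coeff X p = 1"
proof -
  have mX: "- X \<in> carrier_mat p p" using X by simp
  have deg: "degree (char_poly (- X)) = p" and "coeff (char_poly (- X)) p = 1"
    using degree_monic_char_poly[OF mX] by auto
  then show "det_coeff X p = 1" by (simp add: det_coeff_def)
  have hom: "comm_ring_hom (\<lambda>q. poly q (- l))" by unfold_locales auto
  have "map_mat (\<lambda>q. poly q (- l)) (char_poly_matrix (- X)) = X - l \<cdot>\<^sub>m 1\<^sub>m p"
    using X by (intro eq_matI) (auto simp: char_poly_matrix_def)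
  then have "det (X - l \<cdot>\<^sub>m 1\<^sub>m p) = poly (char_poly (- X)) (- l)"
    unfolding char_poly_def by (metis comm_ring_hom.hom_det[OF hom])
  then show "det (X - l \<cdot>\<^sub>m 1\<^sub>m p) = (\<Sum>j\<le>p. det_coeff X j * (- l) ^ j)"
    by (simp add: poly_altdef deg det_coeff_def)
qed

definition select_cols :: "real mat \<Rightarrow> nat list \<Rightarrow> real mat" where
  "select_cols M S = mat_of_cols (dim_row M) (map (col M) S)"

definition select_rows :: "real mat \<Rightarrow> nat list \<Rightarrow> real mat" where
  "select_rows M S = mat_of_rows (dim_col M) (map (row M) S)"

text \<open>\<open>deflate B i\<close> is \<open>(Id - b b\<^sup>T / \<parallel>b\<parallel>\<^sup>2) B\<close>, where \<open>b\<close> is column \<open>i\<close> of \<open>B\<close>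
  (columns are numbered from 0).\<close>

definition deflate :: "real mat \<Rightarrow> nat \<Rightarrow> real mat" where
  "deflate B i =
     (let p = dim_row B; b = col B i
      in (1\<^sub>m p - (1 / (b \<bullet> b)) \<cdot>\<^sub>m (mat_of_cols p [b] * mat_of_rows p [b])) * B)"

definition css_ratio :: "nat \<Rightarrow> nat \<Rightarrow> real mat \<Rightarrow> nat \<Rightarrow> real" where
  "css_ratio k t B i =
     (let p = dim_row B; G = deflate B i * transpose_mat (deflate B i)
      in det_coeff G (p - k + t - 1) / det_coeff G (p - k + t))"

text \<open>Because ties between minimizers may be broken arbitrarily, the algorithm is a
  relation: \<open>css_state M k S B\<close> says that \<open>S\<close> and \<open>B\<close> are possible values of the
  program variables after \<open>length S\<close> passes through the loop, so that the pass
  starting in this state is number \<open>t = length S + 1\<close>.\<close>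

inductive css_state :: "real mat \<Rightarrow> nat \<Rightarrow> nat list \<Rightarrow> real mat \<Rightarrow> bool"
  for M :: "real mat" and k :: nat where
  init: "css_state M k [] M"
| step: "css_state M k (S @ [i])
           (M - select_cols M (S @ [i]) * moore_penrose (select_cols M (S @ [i])) * M)"
  if "css_state M k S B"
    and "length S < k"
    and "is_arg_min (css_ratio k (length S + 1) B)
           (\<lambda>i. i < dim_col M \<and> col B i \<noteq> 0\<^sub>v (dim_row M)) i"

definition css_output :: "real mat \<Rightarrow> nat \<Rightarrow> nat list \<Rightarrow> bool" where
  "css_output M k S \<longleftrightarrow> length S = k \<and> (\<exists>B. css_state M k S B)"

end

theory Submission
  imports Defs
begin

text \<open>Let \<open>e\<^sub>j(B)\<close> be the elementary symmetric polynomials of the eigenvalues of \<open>B B\<^sup>T\<close>, and let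
  \<open>B\<^sub>i\<close> be \<open>B\<close> projected onto the complement of its column \<open>b\<^sub>i\<close>. Diagonalizing \<open>B B\<^sup>T\<close> and
  applying the matrix determinant lemma gives
  \<open>\<Sum>\<^sub>i \<parallel>b\<^sub>i\<parallel>\<^sup>2 e\<^sub>j(B\<^sub>i) = (j + 1) e\<^sub>j\<^sub>+\<^sub>1(B)\<close>. Using this for \<open>j\<close> and \<open>j + 1\<close>, the minimal ratio
  \<open>r = min\<^sub>i e\<^sub>j\<^sub>+\<^sub>1(B\<^sub>i) / e\<^sub>j(B\<^sub>i)\<close> satisfies \<open>(j + 1) r \<le> (j + 2) e\<^sub>j\<^sub>+\<^sub>2(B) / e\<^sub>j\<^sub>+\<^sub>1(B)\<close>, so
  that \<open>(j + 1) e\<^sub>j\<^sub>+\<^sub>1 / e\<^sub>j\<close> at \<open>j = k - t\<close> never increases along the algorithm. It starts at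
  \<open>(k + 1) e\<^sub>k\<^sub>+\<^sub>1(A) / e\<^sub>k(A) \<le> (k + 1) (\<sigma>\<^sub>k\<^sub>+\<^sub>1\<^sup>2 + \<dots> + \<sigma>\<^sub>m\<^sup>2)\<close> and ends at the squared error of the
  column selection. The row selection obeys the same bound since \<open>A\<close> and \<open>A\<^sup>T\<close> have the same
  \<open>e\<^sub>j\<close>, and by Pythagoras the squared error of \<open>C U R = C C\<^sup>+ A R\<^sup>+ R\<close> is at most the sum of both.\<close>

subsection \<open>Diagonalization of symmetric matrices\<close>

text \<open>Sylvester's determinant identity. One block matrix factors both as
  \<open>?L * ?U\<close> and as \<open>?U' * ?L\<close>; all factors are block triangular, and
  comparing the two determinants gives the claim.\<close>

lemma det_one_plus_mult_commute:
  fixes X Y :: "'a :: idom mat"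
  assumes X: "X \<in> carrier_mat n m" and Y: "Y \<in> carrier_mat m n"
  shows "det (1\<^sub>m n + X * Y) = det (1\<^sub>m m + Y * X)"
proof -
  have XY: "X * Y \<in> carrier_mat n n" and YX: "Y * X \<in> carrier_mat m m" using X Y by auto
  let ?M = "four_block_mat (1\<^sub>m n) (- X) Y (1\<^sub>m m)"
  let ?L = "four_block_mat (1\<^sub>m n) (0\<^sub>m n m) Y (1\<^sub>m m)"
  let ?U = "four_block_mat (1\<^sub>m n) (- X) (0\<^sub>m m n) (1\<^sub>m m + Y * X)"
  let ?U' = "four_block_mat (1\<^sub>m n + X * Y) (- X) (0\<^sub>m m n) (1\<^sub>m m)"
  have carr: "?L \<in> carrier_mat (n + m) (n + m)" "?U \<in> carrier_mat (n + m) (n + m)"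
    "?U' \<in> carrier_mat (n + m) (n + m)" using X Y by auto
  have "?L * ?U = four_block_mat (1\<^sub>m n * 1\<^sub>m n + 0\<^sub>m n m * 0\<^sub>m m n)
      (1\<^sub>m n * (- X) + 0\<^sub>m n m * (1\<^sub>m m + Y * X)) (Y * 1\<^sub>m n + 1\<^sub>m m * 0\<^sub>m m n)
      (Y * (- X) + 1\<^sub>m m * (1\<^sub>m m + Y * X))"
    using X Y by (intro mult_four_block_mat) auto
  also have "\<dots> = ?M"
    using X Y YX by (intro cong_four_block_mat) (auto intro!: eq_matI)
  finally have 1: "?L * ?U = ?M" .
  have "?U' * ?L = four_block_mat ((1\<^sub>m n + X * Y) * 1\<^sub>m n + (- X) * Y)
      ((1\<^sub>m n + X * Y) * 0\<^sub>m n m + (- X) * 1\<^sub>m m) (0\<^sub>m m n * 1\<^sub>m n + 1\<^sub>m m * Y)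
      (0\<^sub>m m n * 0\<^sub>m n m + 1\<^sub>m m * 1\<^sub>m m)"
    using X Y by (intro mult_four_block_mat) auto
  also have "\<dots> = ?M"
    using X Y XY by (intro cong_four_block_mat) (auto intro!: eq_matI)
  finally have 2: "?U' * ?L = ?M" .
  have L: "det ?L = 1"
    using Y by (subst det_four_block_mat_upper_right_zero) auto
  have U: "det ?U = det (1\<^sub>m m + Y * X)"
    using X YX by (subst det_four_block_mat_lower_left_zero) auto
  have U': "det ?U' = det (1\<^sub>m n + X * Y)"
    using X XY by (subst det_four_block_mat_lower_left_zero) auto
  show ?thesis
    using det_mult[OF carr(1,2)] det_mult[OF carr(3,1)] by (simp add: 1 2 L U U')
qed

lemma symmetric_scalar_prod:
  fixes G :: "'a :: comm_ring_1 mat"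
  assumes "G \<in> carrier_mat n n" "transpose_mat G = G" "v \<in> carrier_vec n" "w \<in> carrier_vec n"
  shows "v \<bullet> (G *\<^sub>v w) = (G *\<^sub>v v) \<bullet> w"
  by (metis assms transpose_vec_mult_scalar)

text \<open>The fundamental theorem of algebra yields a complex eigenpair \<open>z\<close>,
  \<open>u\<close>. Symmetry forces \<open>z\<close> to be real, so whichever of the real and
  imaginary parts of \<open>u\<close> is nonzero is a real eigenvector.\<close>

lemma symmetric_eigenvector:
  fixes G :: "real mat"
  assumes G: "G \<in> carrier_mat n n" and sym: "transpose_mat G = G" and n: "0 < n"
  obtains v l where "v \<in> carrier_vec n" "v \<noteq> 0\<^sub>v n" "G *\<^sub>v v = l \<cdot>\<^sub>v v"
proof -
  define H where "H = map_mat complex_of_real G"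
  have H: "H \<in> carrier_mat n n" using G by (simp add: H_def)
  have "degree (char_poly H) = n" using degree_monic_char_poly[OF H] by simp
  then have "\<not> constant (poly (char_poly H))" using n by (simp add: constant_degree)
  then obtain z where "poly (char_poly H) z = 0"
    using fundamental_theorem_of_algebra by blast
  then have "eigenvalue H z" using eigenvalue_root_char_poly[OF H] by simp
  then obtain u where u: "u \<in> carrier_vec n" "u \<noteq> 0\<^sub>v n" "H *\<^sub>v u = z \<cdot>\<^sub>v u"
    using H unfolding eigenvalue_def eigenvector_def by auto
  define a b where "a = map_vec Re u" and "b = map_vec Im u"
  have a: "a \<in> carrier_vec n" and b: "b \<in> carrier_vec n" using u by (auto simp: a_def b_def)
  have ent: "(\<Sum>j<n. complex_of_real (G $$ (i, j)) * u $ j) = z * u $ i" if "i < n" for i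
  proof -
    have "(H *\<^sub>v u) $ i = (\<Sum>j<n. complex_of_real (G $$ (i, j)) * u $ j)"
      using that H u(1) G by (auto simp: H_def scalar_prod_def atLeast0LessThan intro!: sum.cong)
    then show ?thesis using u that by simp
  qed
  have Ga: "G *\<^sub>v a = Re z \<cdot>\<^sub>v a - Im z \<cdot>\<^sub>v b"
  proof (rule eq_vecI)
    fix i assume "i < dim_vec (Re z \<cdot>\<^sub>v a - Im z \<cdot>\<^sub>v b)"
    then have i: "i < n" using a b by auto
    show "(G *\<^sub>v a) $ i = (Re z \<cdot>\<^sub>v a - Im z \<cdot>\<^sub>v b) $ i"
      using arg_cong[OF ent[OF i], of Re] i u(1) G
      by (auto simp: a_def b_def scalar_prod_def atLeast0LessThan)
  qed (use G a b in auto)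
  have Gb: "G *\<^sub>v b = Im z \<cdot>\<^sub>v a + Re z \<cdot>\<^sub>v b"
  proof (rule eq_vecI)
    fix i assume "i < dim_vec (Im z \<cdot>\<^sub>v a + Re z \<cdot>\<^sub>v b)"
    then have i: "i < n" using a b by auto
    show "(G *\<^sub>v b) $ i = (Im z \<cdot>\<^sub>v a + Re z \<cdot>\<^sub>v b) $ i"
      using arg_cong[OF ent[OF i], of Im] i u(1) G
      by (auto simp: a_def b_def scalar_prod_def atLeast0LessThan algebra_simps)
  qed (use G a b in auto)
  have ab: "a \<noteq> 0\<^sub>v n \<or> b \<noteq> 0\<^sub>v n"
  proof (rule ccontr)
    assume "\<not> ?thesis"
    then have "u $ i = 0" if "i < n" for i
      using that u(1) by (auto simp: a_def b_def vec_eq_iff complex_eq_iff)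
    then show False using u by (auto simp: vec_eq_iff)
  qed
  have pos: "x \<bullet> x \<ge> 0" "x \<bullet> x = 0 \<longleftrightarrow> x = 0\<^sub>v n" if "x \<in> carrier_vec n" for x :: "real vec"
    using that conjugate_square_eq_0_vec[of x n] conjugate_square_ge_0_vec[of x]
    by (auto simp: scalar_prod_def conjugate_vec_def vec_eq_iff intro!: sum_nonneg)
  have "a \<bullet> (G *\<^sub>v b) = (G *\<^sub>v a) \<bullet> b" by (rule symmetric_scalar_prod[OF G sym a b])
  then have "Im z * (a \<bullet> a + b \<bullet> b) = 0"
    using a b by (simp add: Ga Gb scalar_prod_add_distrib[of _ n] minus_scalar_prod_distrib[of _ n]
       algebra_simps)
  then have z: "Im z = 0"
    using ab pos[OF a] pos[OF b] by (smt (verit) mult_eq_0_iff)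
  from ab show ?thesis
  proof
    assume "a \<noteq> 0\<^sub>v n"
    then show ?thesis using that[OF a, of "Re z"] Ga a b z by (auto simp: vec_eq_iff)
  next
    assume "b \<noteq> 0\<^sub>v n"
    then show ?thesis using that[OF b, of "Re z"] Gb a b z by (auto simp: vec_eq_iff)
  qed
qed

text \<open>Supplies an orthogonal matrix with a prescribed first column, which moves a unit
  eigenvector to the first basis vector in the diagonalization. For \<open>v = unit_vec n 0\<close>
  the reflection vector would vanish, hence the case split.\<close>

lemma householder:
  fixes v :: "real vec"
  assumes v: "v \<in> carrier_vec n" and n: "0 < n" and unit: "v \<bullet> v = 1"
  obtains H where "H \<in> carrier_mat n n" "transpose_mat H = H" "H * H = 1\<^sub>m n" "col H 0 = v"
proof (cases "v = unit_vec n 0")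
  case True
  then show ?thesis using that[of "1\<^sub>m n"] n by auto
next
  case False
  \<comment> \<open>reflection in the hyperplane orthogonal to \<open>v - e\<^sub>0\<close>\<close>
  define w where "w i = v $ i - (if i = 0 then 1 else 0)" for i
  define s where "s = (\<Sum>i<n. (w i)\<^sup>2)"
  define c where "c = 2 / s"
  obtain i where i: "i < n" "w i \<noteq> 0"
    using False v by (auto simp: w_def vec_eq_iff unit_vec_def)
  then have s0: "s > 0" unfolding s_def by (intro sum_pos2[of _ i]) auto
  define H where "H = mat n n (\<lambda>(i, j). (if i = j then 1 else 0) - c * w i * w j)"
  have "s = (\<Sum>i<n. (v $ i)\<^sup>2 - (if i = 0 then 2 * v $ 0 - 1 else 0))"
    unfolding s_def w_def by (intro sum.cong) (auto simp: power2_eq_square algebra_simps)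
  also have "\<dots> = (\<Sum>i<n. (v $ i)\<^sup>2) - (2 * v $ 0 - 1)"
    using n by (simp add: sum_subtractf sum.delta)
  also have "(\<Sum>i<n. (v $ i)\<^sup>2) = 1"
    using unit v by (simp add: scalar_prod_def atLeast0LessThan power2_eq_square)
  finally have s: "s = - 2 * w 0" by (simp add: w_def)
  \<comment> \<open>This value makes column 0 of \<open>H\<close> equal to the first basis vector
    plus \<open>w\<close>, which is \<open>v\<close>.\<close>
  have cs: "c * w 0 = -1" using s s0 by (simp add: c_def)
  have "H * H = 1\<^sub>m n"
  proof (rule eq_matI)
    fix i j assume "i < dim_row (1\<^sub>m n :: real mat)" "j < dim_col (1\<^sub>m n :: real mat)"
    then have ij: "i < n" "j < n" by auto
    have "(H * H) $$ (i, j) = (\<Sum>l<n. ((if i = l then 1 else 0) - c * w i * w l) *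
        ((if l = j then 1 else 0) - c * w l * w j))"
      using ij by (simp add: H_def scalar_prod_def atLeast0LessThan)
    also have "\<dots> = (\<Sum>l<n. (if l = i then (if i = j then 1 else 0) - c * w i * w j else 0)
         - (if l = j then c * w i * w j else 0) + c * c * w i * w j * (w l)\<^sup>2)"
      by (intro sum.cong) (auto simp: algebra_simps power2_eq_square)
    also have "\<dots> = (if i = j then 1 else 0) - 2 * (c * w i * w j) + c * c * w i * w j * s"
      using ij by (simp add: sum.distrib sum_subtractf s_def sum_distrib_left[symmetric])
    also have "\<dots> = (if i = j then 1 else 0)" using s0 by (simp add: c_def)
    finally show "(H * H) $$ (i, j) = 1\<^sub>m n $$ (i, j)" using ij by simp
  qed (auto simp: H_def)
  moreover have "col H 0 = v"
  proof (rule eq_vecI)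
    fix i assume "i < dim_vec v"
    then have i: "i < n" using v by auto
    have "c * w i * w 0 = (c * w 0) * w i" by simp
    then have "c * w i * w 0 = - w i" by (simp add: cs)
    then show "col H 0 $ i = v $ i" using i n by (auto simp: H_def) (simp_all add: w_def)
  qed (use v n in \<open>auto simp: H_def\<close>)
  moreover have "transpose_mat H = H" by (auto simp: H_def intro!: eq_matI)
  ultimately show ?thesis using that[of H] by (simp add: H_def)
qed

text \<open>Spectral theorem by induction on the size: conjugation with a Householder reflection
  whose first column is a unit eigenvector clears the first column, symmetry clears the first row,
  and the induction hypothesis handles the remaining block.\<close>

lemma symmetric_diagonalization:
  fixes G :: "real mat"
  assumes "G \<in> carrier_mat n n" "transpose_mat G = G"
  shows "\<exists>V d. V \<in> carrier_mat n n \<and> transpose_mat V * V = 1\<^sub>m n \<and>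
           G = V * mat_diag n d * transpose_mat V"
  using assms
proof (induction n arbitrary: G)
  case 0
  then show ?case by (intro exI[of _ "1\<^sub>m 0"]) (auto intro!: eq_matI)
next
  case (Suc n)
  note G = Suc.prems
  obtain u l where u: "u \<in> carrier_vec (Suc n)" "u \<noteq> 0\<^sub>v (Suc n)" "G *\<^sub>v u = l \<cdot>\<^sub>v u"
    using symmetric_eigenvector[OF G] by blast
  have uu: "u \<bullet> u > 0"
    using conjugate_square_greater_0_vec[OF u(1)] u by (simp add: scalar_prod_def conjugate_vec_def)
  define v where "v = (1 / sqrt (u \<bullet> u)) \<cdot>\<^sub>v u"
  have v: "v \<in> carrier_vec (Suc n)" using u by (simp add: v_def)
  have vv: "v \<bullet> v = 1" using u uu by (simp add: v_def)
  have Gv: "G *\<^sub>v v = l \<cdot>\<^sub>v v" using u G by (simp add: v_def mult_mat_vec smult_smult_assoc mult.commute)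
  obtain H where H: "H \<in> carrier_mat (Suc n) (Suc n)" "transpose_mat H = H" "H * H = 1\<^sub>m (Suc n)"
    "col H 0 = v" using householder[OF v _ vv] by auto
  define K where "K = H * G * H"
  have K: "K \<in> carrier_mat (Suc n) (Suc n)" using H G by (auto simp: K_def)
  have Ksym: "transpose_mat K = K" using H G by (simp add: K_def transpose_mult[of _ "Suc n" "Suc n" _ "Suc n"] assoc_mult_mat[of _ "Suc n" "Suc n" _ "Suc n" _ "Suc n"])
  \<comment> \<open>\<open>H\<close> sends the first basis vector to \<open>v\<close>,
    \<open>G\<close> scales \<open>v\<close> by \<open>l\<close>, and the involution
    \<open>H\<close> sends \<open>v\<close> back.\<close>
  have "col K 0 = col (H * (G * H)) 0"
    using assoc_mult_mat[OF H(1) G(1) H(1)] by (simp only: K_def)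
  also have "\<dots> = H *\<^sub>v (G *\<^sub>v v)"
    using col_mult2[OF H(1) mult_carrier_mat[OF G(1) H(1)], of 0] col_mult2[OF G(1) H(1), of 0]
    by (simp only: H(4) zero_less_Suc)
  also have "\<dots> = l \<cdot>\<^sub>v (H *\<^sub>v col H 0)" using H v by (simp add: Gv mult_mat_vec)
  also have "H *\<^sub>v col H 0 = col (H * H) 0" using col_mult2[OF H(1) H(1), of 0] by (simp only: zero_less_Suc)
  finally have K0: "col K 0 = l \<cdot>\<^sub>v unit_vec (Suc n) 0" by (simp add: H)
  have Ki0: "K $$ (i, 0) = (if i = 0 then l else 0)" if "i < Suc n" for i
    using arg_cong[OF K0, of "\<lambda>x. x $ i"] that K by simp
  have K0i: "K $$ (0, i) = (if i = 0 then l else 0)" if "i < Suc n" for i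
    using Ki0[OF that] Ksym K that by (metis carrier_matD index_transpose_mat(1) zero_less_Suc)
  define K' where "K' = mat n n (\<lambda>(i, j). K $$ (Suc i, Suc j))"
  have "K $$ (Suc i, Suc j) = K $$ (Suc j, Suc i)" if "i < n" "j < n" for i j
    using Ksym K that by (metis Suc_less_eq carrier_matD index_transpose_mat(1))
  then have "transpose_mat K' = K'" by (auto simp: K'_def intro!: eq_matI)
  then obtain V d where V: "V \<in> carrier_mat n n" "transpose_mat V * V = 1\<^sub>m n"
    "K' = V * mat_diag n d * transpose_mat V"
    using Suc.IH[of K'] by (auto simp: K'_def)
  define d' where "d' i = (case i of 0 \<Rightarrow> l | Suc j \<Rightarrow> d j)" for i
  define W where "W = four_block_mat (1\<^sub>m 1) (0\<^sub>m 1 n) (0\<^sub>m n 1) V"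
  have W: "W \<in> carrier_mat (Suc n) (Suc n)" using V by (auto simp: W_def)
  have Wt: "transpose_mat W = four_block_mat (1\<^sub>m 1) (0\<^sub>m 1 n) (0\<^sub>m n 1) (transpose_mat V)"
    using V by (simp add: W_def transpose_four_block_mat[of _ 1 1 _ n _ n])
  have D: "mat_diag (Suc n) d' = four_block_mat (mat_diag 1 (\<lambda>_. l)) (0\<^sub>m 1 n) (0\<^sub>m n 1) (mat_diag n d)"
    by (auto simp: mat_diag_def d'_def intro!: eq_matI split: nat.splits)
  have WW: "transpose_mat W * W = 1\<^sub>m (Suc n)"
    unfolding Wt unfolding W_def using V
    by (subst mult_four_block_mat[of _ 1 1 _ n _ n _ _ 1 _ n]) (auto simp: four_block_one_mat)
  have "W * mat_diag (Suc n) d' = four_block_mat (mat_diag 1 (\<lambda>_. l)) (0\<^sub>m 1 n) (0\<^sub>m n 1) (V * mat_diag n d)"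
    unfolding D unfolding W_def using V
    by (subst mult_four_block_mat[of _ 1 1 _ n _ n _ _ 1 _ n])
       (auto intro!: cong_four_block_mat simp: left_mult_one_mat[OF mat_diag_dim]
         left_mult_zero_mat[OF mat_diag_dim] right_mult_zero_mat[OF mat_diag_dim]
         right_add_zero_mat[OF mat_diag_dim])
  then have "W * mat_diag (Suc n) d' * transpose_mat W =
      four_block_mat (mat_diag 1 (\<lambda>_. l)) (0\<^sub>m 1 n) (0\<^sub>m n 1) K'"
    unfolding Wt V(3) using V(1)
    by (simp, subst mult_four_block_mat[of _ 1 1 _ n _ n _ _ 1 _ n])
       (auto intro!: cong_four_block_mat simp: right_mult_one_mat[OF mat_diag_dim]
         right_mult_zero_mat[OF mat_diag_dim] right_add_zero_mat[OF mat_diag_dim])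
  also have "\<dots> = K"
    using K Ki0 K0i by (auto simp: K'_def mat_diag_def intro!: eq_matI)
  finally have K2: "K = W * mat_diag (Suc n) d' * transpose_mat W" by simp
  have HK: "H * K * H = G"
  proof -
    have "H * K * H = (H * H) * G * (H * H)"
      using H(1) G(1) by (simp add: K_def assoc_mult_mat[of _ "Suc n" "Suc n" _ "Suc n" _ "Suc n"])
    then show ?thesis using G by (simp add: H)
  qed
  let ?W = "H * W"
  have "transpose_mat ?W * ?W = transpose_mat W * (H * H) * W"
    using H(1,2) W by (simp add: transpose_mult[of _ "Suc n" "Suc n" _ "Suc n"] assoc_mult_mat[of _ "Suc n" "Suc n" _ "Suc n" _ "Suc n"])
  also have "\<dots> = 1\<^sub>m (Suc n)" using W by (simp add: H WW)
  finally have 1: "transpose_mat ?W * ?W = 1\<^sub>m (Suc n)" .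
  have "?W * D * transpose_mat ?W = H * (W * D * transpose_mat W) * H"
    if "D \<in> carrier_mat (Suc n) (Suc n)" for D
    using that H(1,2) W by (simp add: transpose_mult[of _ "Suc n" "Suc n" _ "Suc n"] assoc_mult_mat[of _ "Suc n" "Suc n" _ "Suc n" _ "Suc n"])
  from this[of "mat_diag (Suc n) d'"] have "?W * mat_diag (Suc n) d' * transpose_mat ?W = G"
    by (simp add: HK[symmetric] K2)
  then show ?case using 1 H(1) W by (intro exI[of _ ?W] exI[of _ d']) auto
qed

subsection \<open>The characteristic polynomial of a projected Gram matrix\<close>

text \<open>In the notation of the paper, \<open>coeff (gram_poly B) j\<close> is \<open>c\<^sub>p\<^sub>-\<^sub>j(B B\<^sup>T)\<close> for \<open>j \<le> p\<close> and \<open>0\<close>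
  for \<open>j > p\<close>; the reflection makes the index independent of \<open>p\<close>.\<close>

definition gram_poly :: "real mat \<Rightarrow> real poly" where
  "gram_poly B = reflect_poly (char_poly (- (B * transpose_mat B)))"

lemma det_coeff_gram_poly:
  assumes "B \<in> carrier_mat p q" "j \<le> p"
  shows "det_coeff (B * transpose_mat B) (p - j) = coeff (gram_poly B) j"
proof -
  have "- (B * transpose_mat B) \<in> carrier_mat p p" using assms by auto
  then have "degree (char_poly (- (B * transpose_mat B))) = p" using degree_monic_char_poly by blast
  then show ?thesis using assms by (simp add: det_coeff_def gram_poly_def coeff_reflect_poly)
qed

lemma poly_char_poly:
  fixes A :: "'a :: comm_ring_1 mat"
  assumes "A \<in> carrier_mat n n"
  shows "poly (char_poly A) x = det (x \<cdot>\<^sub>m 1\<^sub>m n - A)"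
proof -
  have hom: "comm_ring_hom (\<lambda>q. poly q x)" by unfold_locales auto
  have "map_mat (\<lambda>q. poly q x) (char_poly_matrix A) = x \<cdot>\<^sub>m 1\<^sub>m n - A"
    using assms by (intro eq_matI) (auto simp: char_poly_matrix_def)
  then show ?thesis unfolding char_poly_def by (metis comm_ring_hom.hom_det[OF hom])
qed

text \<open>Reflection turns det(y Id + G) into det(Id + x G) through y = 1/x; the point
  \<open>x = 0\<close> is settled by the leading coefficient.\<close>

lemma poly_gram_poly:
  assumes B: "B \<in> carrier_mat p q"
  shows "poly (gram_poly B) x = det (1\<^sub>m p + x \<cdot>\<^sub>m (B * transpose_mat B))"
proof -
  let ?G = "B * transpose_mat B"
  have G: "?G \<in> carrier_mat p p" and mG: "- ?G \<in> carrier_mat p p" using B by auto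
  have deg: "degree (char_poly (- ?G)) = p" and lead: "lead_coeff (char_poly (- ?G)) = 1"
    using degree_monic_char_poly[OF mG] by auto
  show ?thesis
  proof (cases "x = 0")
    case True
    have "1\<^sub>m p + 0 \<cdot>\<^sub>m ?G = 1\<^sub>m p" using G by (intro eq_matI) auto
    then show ?thesis using True lead by (simp add: gram_poly_def)
  next
    case False
    have "x \<cdot>\<^sub>m (inverse x \<cdot>\<^sub>m 1\<^sub>m p - (- ?G)) = 1\<^sub>m p + x \<cdot>\<^sub>m ?G"
      using G False by (intro eq_matI) (auto simp: field_simps)
    moreover have "det (x \<cdot>\<^sub>m (inverse x \<cdot>\<^sub>m 1\<^sub>m p - (- ?G))) = x ^ p * det (inverse x \<cdot>\<^sub>m 1\<^sub>m p - (- ?G))"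
      using B by simp
    ultimately show ?thesis using False
      by (simp add: gram_poly_def poly_reflect_poly_nz deg poly_char_poly[OF mG])
  qed
qed

text \<open>A direct use of Sylvester's identity. It lets the row selection share the bound of the
  column selection although the two Gram matrices differ in size.\<close>

lemma gram_poly_transpose:
  assumes A: "A \<in> carrier_mat m n"
  shows "gram_poly (transpose_mat A) = gram_poly A"
proof -
  have "poly (gram_poly (transpose_mat A)) x = poly (gram_poly A) x" for x
    using det_one_plus_mult_commute[of "x \<cdot>\<^sub>m A" m n "transpose_mat A"] A
    by (simp add: poly_gram_poly[of _ n m] poly_gram_poly[of _ m n]
        mult_smult_distrib[of _ n m] mult_smult_assoc_mat[of _ m n])
  then show ?thesis by (simp add: poly_eq_poly_eq_iff[symmetric] fun_eq_iff)
qed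

lemma mult_transpose_diag:
  fixes W :: "real mat"
  assumes "W \<in> carrier_mat p q" "i < p"
  shows "(W * transpose_mat W) $$ (i, i) = (\<Sum>j<q. (W $$ (i, j))\<^sup>2)"
  using assms by (auto simp: scalar_prod_def power2_eq_square atLeast0LessThan)

text \<open>With W = V^T B one has W W^T = diag(d), so each eigenvalue is the squared norm of a row
  of W. This yields nonnegativity and ties the eigenvalues to the columns of
  \<open>B\<close>.\<close>

lemma gram_diagonalization:
  fixes B :: "real mat"
  assumes B: "B \<in> carrier_mat p q"
  obtains V d where "V \<in> carrier_mat p p" "transpose_mat V * V = 1\<^sub>m p" "V * transpose_mat V = 1\<^sub>m p"
    "B * transpose_mat B = V * mat_diag p d * transpose_mat V"
    "\<And>i. i < p \<Longrightarrow> d i = (\<Sum>j<q. ((transpose_mat V * B) $$ (i, j))\<^sup>2)"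
proof -
  have "transpose_mat (B * transpose_mat B) = B * transpose_mat B" "B * transpose_mat B \<in> carrier_mat p p"
    using B by (simp_all add: transpose_mult[of _ p q _ p])
  then obtain V d where V: "V \<in> carrier_mat p p" "transpose_mat V * V = 1\<^sub>m p"
    "B * transpose_mat B = V * mat_diag p d * transpose_mat V"
    using symmetric_diagonalization by blast
  have Vt: "transpose_mat V \<in> carrier_mat p p" using V by simp
  have V': "V * transpose_mat V = 1\<^sub>m p" using mat_mult_left_right_inverse[OF Vt V(1,2)] .
  have assoc: "transpose_mat V * (V * D * transpose_mat V) * V = (transpose_mat V * V) * D * (transpose_mat V * V)"
    if "D \<in> carrier_mat p p" for D
    using that V(1) by (simp add: assoc_mult_mat[of _ p p _ p _ p])
  let ?W = "transpose_mat V * B"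
  have "?W * transpose_mat ?W = transpose_mat V * (B * transpose_mat B) * V"
    using V(1) B
    by (simp add: transpose_mult[of _ p p _ q] assoc_mult_mat[of _ p p _ q _ p]
        assoc_mult_mat[of _ p q _ p _ p] assoc_mult_mat[of _ p p _ p _ p])
  also have "\<dots> = mat_diag p d"
    using V(2) assoc[of "mat_diag p d"]
    by (simp add: V(3) left_mult_one_mat[OF mat_diag_dim] right_mult_one_mat[OF mat_diag_dim])
  finally have W: "?W * transpose_mat ?W = mat_diag p d" .
  have "d i = (\<Sum>j<q. (?W $$ (i, j))\<^sup>2)" if "i < p" for i
    using mult_transpose_diag[of ?W p q i] V(1) B that
    unfolding W by (simp add: mat_diag_def)
  then show ?thesis using that[OF V(1,2) V' V(3)] by blast
qed

lemma det_mat_diag: "det (mat_diag n f) = (\<Prod>i<n. f i)" for f :: "nat \<Rightarrow> 'a :: comm_ring_1"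
proof -
  have "det (mat_diag n f) = prod_list (diag_mat (mat_diag n f))"
    by (rule det_upper_triangular[of _ n]) (auto simp: mat_diag_def)
  also have "\<dots> = (\<Prod>i\<leftarrow>[0..<n]. f i)"
    by (auto simp: diag_mat_def mat_diag_def intro!: arg_cong[of _ _ prod_list])
  also have "\<dots> = (\<Prod>i<n. f i)" by (simp add: interv_sum_list_conv_sum_set_nat prod.distinct_set_conv_list[symmetric] atLeast0LessThan)
  finally show ?thesis .
qed

text \<open>Sylvester's identity cancels \<open>V\<close> against its transpose. Hence coefficient j
  of \<open>gram_poly B\<close> is the elementary symmetric polynomial e_j of the
  eigenvalues.\<close>

lemma gram_poly_eq_prod:
  assumes B: "B \<in> carrier_mat p q" and V: "V \<in> carrier_mat p p" "transpose_mat V * V = 1\<^sub>m p"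
    and G: "B * transpose_mat B = V * mat_diag p d * transpose_mat V"
  shows "gram_poly B = (\<Prod>i<p. [:1, d i:])"
proof -
  have "poly (gram_poly B) x = poly (\<Prod>i<p. [:1, d i:]) x" for x
  proof -
    have D: "mat_diag p d \<in> carrier_mat p p" by simp
    have "x \<cdot>\<^sub>m (V * D * transpose_mat V) = (x \<cdot>\<^sub>m (V * D)) * transpose_mat V"
      "transpose_mat V * (x \<cdot>\<^sub>m (V * D)) = x \<cdot>\<^sub>m ((transpose_mat V * V) * D)"
      "x \<cdot>\<^sub>m (V * D) \<in> carrier_mat p p"
      if "D \<in> carrier_mat p p" for D
      using that V(1) by (auto simp: mult_smult_assoc_mat[of _ p p] mult_smult_distrib[of _ p p] assoc_mult_mat[of _ p p _ p _ p])
    note * = this[OF D]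
    have "poly (gram_poly B) x = det (1\<^sub>m p + x \<cdot>\<^sub>m mat_diag p d)"
      using det_one_plus_mult_commute[OF *(3), of "transpose_mat V"] V(1)
      by (simp add: poly_gram_poly[OF B] G * V(2) left_mult_one_mat[OF mat_diag_dim])
    also have "1\<^sub>m p + x \<cdot>\<^sub>m mat_diag p d = mat_diag p (\<lambda>i. 1 + x * d i)"
      by (intro eq_matI) (auto simp: mat_diag_def)
    finally show ?thesis by (simp add: det_mat_diag poly_prod)
  qed
  then show ?thesis by (simp add: poly_eq_poly_eq_iff[symmetric] fun_eq_iff)
qed

text \<open>This is an orthogonal projection only when \<open>u\<close> is a unit vector;
  normalization is left to the user.\<close>

definition proj_compl :: "nat \<Rightarrow> real vec \<Rightarrow> real mat" where
  "proj_compl p u = mat p p (\<lambda>(i, j). (if i = j then 1 else 0) - u $ i * u $ j)"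

text \<open>Matrix determinant lemma: factoring out the invertible diagonal leaves the identity plus
  a rank one matrix \<open>X * Y\<close>, and Sylvester's identity reduces that determinant to size
  1.\<close>

lemma det_diag_minus_rank_one:
  fixes w d :: "nat \<Rightarrow> real"
  assumes w: "(\<Sum>i<p. (w i)\<^sup>2) = 1" and nz: "\<And>i. i < p \<Longrightarrow> 1 + x * d i \<noteq> 0"
  shows "det (mat p p (\<lambda>(i, j). (if i = j then 1 + x * d i else 0) - x * w i * w j * d j)) =
    (\<Sum>l<p. (w l)\<^sup>2 * (\<Prod>i\<in>{..<p} - {l}. 1 + x * d i))"
proof -
  define X where "X = mat p 1 (\<lambda>(i, j). - x * w i / (1 + x * d i))"
  define Y where "Y = mat 1 p (\<lambda>(i, j). w j * d j)"
  have X: "X \<in> carrier_mat p 1" and Y: "Y \<in> carrier_mat 1 p" by (auto simp: X_def Y_def)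
  let ?E = "mat_diag p (\<lambda>i. 1 + x * d i)"
  have ent: "s * ((if i = j then 1 else 0) + (- x * w i / s) * (w j * d j)) =
      (if i = j then s else 0) - x * w i * w j * d j" if "s \<noteq> 0" for s i j
    using that by (simp add: field_simps)
  have "mat p p (\<lambda>(i, j). (if i = j then 1 + x * d i else 0) - x * w i * w j * d j) = ?E * (1\<^sub>m p + X * Y)"
    using X Y ent[OF nz]
    by (subst mat_diag_mult_left[of _ p p])
       (auto simp: X_def Y_def scalar_prod_def intro!: eq_matI)
  also have "det \<dots> = det ?E * det (1\<^sub>m p + X * Y)"
    using X Y by (intro det_mult) auto
  also have "det (1\<^sub>m p + X * Y) = det (1\<^sub>m 1 + Y * X)"
    using det_one_plus_mult_commute[OF X Y] .
  also have "\<dots> = 1 + (\<Sum>i<p. w i * d i * (- x * w i / (1 + x * d i)))"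
    using X Y by (subst det_single) (auto simp: X_def Y_def scalar_prod_def atLeast0LessThan)
  \<comment> \<open>The constant 1 is rewritten as the sum of the squares of \<open>w\<close>, so
    that each summand simplifies to a single fraction.\<close>
  also have "\<dots> = (\<Sum>i<p. (w i)\<^sup>2 + w i * d i * (- x * w i / (1 + x * d i)))"
    by (simp add: sum_subtractf sum_negf w)
  also have "\<dots> = (\<Sum>i<p. (w i)\<^sup>2 / (1 + x * d i))"
    using nz by (intro sum.cong) (auto simp: field_simps power2_eq_square)
  also have "det ?E * \<dots> = (\<Sum>l<p. (w l)\<^sup>2 * (\<Prod>i\<in>{..<p} - {l}. 1 + x * d i))"
    unfolding det_mat_diag sum_distrib_left
  proof (intro sum.cong refl)
    fix l assume l: "l \<in> {..<p}"
    then show "(\<Prod>i<p. 1 + x * d i) * ((w l)\<^sup>2 / (1 + x * d l)) = (w l)\<^sup>2 * (\<Prod>i\<in>{..<p} - {l}. 1 + x * d i)"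
      using nz[of l] by (subst prod.remove[of _ l]) auto
  qed
  finally show ?thesis .
qed

text \<open>The determinant formula divides by 1 + x d_i, which is known to be nonzero for x >= 0
  and d_i >= 0; a half-line is infinite, hence enough to identify polynomials.\<close>

lemma real_poly_eqI_nonneg:
  fixes f g :: "real poly"
  assumes "\<And>x. x \<ge> 0 \<Longrightarrow> poly f x = poly g x"
  shows "f = g"
proof (rule ccontr)
  assume "f \<noteq> g"
  then have "finite {x. poly (f - g) x = 0}" by (intro poly_roots_finite) simp
  moreover have "{0..} \<subseteq> {x. poly (f - g) x = 0}" using assms by auto
  ultimately show False using infinite_Ici[of "0::real"] finite_subset by blast
qed

text \<open>Sylvester's identity and idempotence of the projection Q reduce Q G Q to Q G. A change
  of basis by \<open>V\<close> then turns Q into Id - w w^T with the unit vector w = V^T u, to which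
  the rank one formula applies.\<close>

lemma gram_poly_proj_compl:
  assumes B: "B \<in> carrier_mat p q" and V: "V \<in> carrier_mat p p" "transpose_mat V * V = 1\<^sub>m p" "V * transpose_mat V = 1\<^sub>m p"
    and G: "B * transpose_mat B = V * mat_diag p d * transpose_mat V"
    and d: "\<And>i. i < p \<Longrightarrow> d i \<ge> 0"
    and u: "u \<in> carrier_vec p" "u \<bullet> u = 1"
  shows "gram_poly (proj_compl p u * B) =
    (\<Sum>l<p. Polynomial.smult (((transpose_mat V *\<^sub>v u) $ l)\<^sup>2) (\<Prod>i\<in>{..<p} - {l}. [:1, d i:]))"
proof (rule real_poly_eqI_nonneg)
  fix x :: real assume x: "x \<ge> 0"
  define Q where "Q = proj_compl p u"
  define w where "w = transpose_mat V *\<^sub>v u"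
  have Q: "Q \<in> carrier_mat p p" by (simp add: Q_def proj_compl_def)
  have Qt: "transpose_mat Q = Q" by (auto simp: Q_def proj_compl_def intro!: eq_matI)
  have w: "w \<in> carrier_vec p" using V u by (simp add: w_def)
  have uu: "(\<Sum>l<p. u $ l * u $ l) = 1" using u by (simp add: scalar_prod_def atLeast0LessThan)
  have "w \<bullet> w = u \<bullet> (V *\<^sub>v (transpose_mat V *\<^sub>v u))"
    using V u unfolding w_def
    by (metis mult_mat_vec_carrier transpose_carrier_mat transpose_vec_mult_scalar)
  also have "V *\<^sub>v (transpose_mat V *\<^sub>v u) = u"
    using V u by (simp add: assoc_mult_mat_vec[symmetric, of _ p p _ p])
  finally have ww: "(\<Sum>i<p. (w $ i)\<^sup>2) = 1"
    using u w by (simp add: scalar_prod_def atLeast0LessThan power2_eq_square)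
  have QQ: "Q * Q = Q"
  proof (rule eq_matI)
    fix i j assume "i < dim_row Q" "j < dim_col Q"
    then have ij: "i < p" "j < p" using Q by auto
    have "(Q * Q) $$ (i, j) = (\<Sum>l<p. ((if i = l then 1 else 0) - u $ i * u $ l) *
        ((if l = j then 1 else 0) - u $ l * u $ j))"
      using ij by (simp add: Q_def proj_compl_def scalar_prod_def atLeast0LessThan)
    also have "\<dots> = (\<Sum>l<p. (if l = i then (if i = j then 1 else 0) - u $ i * u $ j else 0)
         - (if l = j then u $ i * u $ j else 0) + u $ i * u $ j * (u $ l * u $ l))"
      by (intro sum.cong) (auto simp: algebra_simps)
    also have "\<dots> = (if i = j then 1 else 0) - u $ i * u $ j"
      using ij by (simp add: sum.distrib sum_subtractf sum_distrib_left[symmetric] uu)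
    finally show "(Q * Q) $$ (i, j) = Q $$ (i, j)" using ij by (simp add: Q_def proj_compl_def)
  qed (use Q in auto)
  have VQV: "transpose_mat V * Q * V = mat p p (\<lambda>(i, j). (if i = j then 1 else 0) - w $ i * w $ j)"
  proof (rule eq_matI)
    fix i j assume "i < dim_row (mat p p (\<lambda>(i, j). (if i = j then 1 else 0) - w $ i * w $ j))"
      "j < dim_col (mat p p (\<lambda>(i, j). (if i = j then 1 else 0) - w $ i * w $ j))"
    then have ij: "i < p" "j < p" by auto
    have wi: "w $ i = (\<Sum>l<p. V $$ (l, i) * u $ l)" if "i < p" for i
      using V u that by (auto simp: w_def scalar_prod_def atLeast0LessThan)
    have Vij: "(\<Sum>l<p. V $$ (l, i) * V $$ (l, j)) = (if i = j then 1 else 0)"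
      using arg_cong[OF V(2), of "\<lambda>M. M $$ (i, j)"] ij V(1)
      by (simp add: scalar_prod_def atLeast0LessThan)
    have "(transpose_mat V * Q * V) $$ (i, j) = (\<Sum>l<p. (\<Sum>h<p. V $$ (h, i) * Q $$ (h, l)) * V $$ (l, j))"
      using ij V(1) Q by (simp add: scalar_prod_def atLeast0LessThan del: assoc_mult_mat)
    also have "\<dots> = (\<Sum>l<p. (\<Sum>h<p. (if h = l then V $$ (l, i) else 0) - V $$ (h, i) * u $ h * u $ l) * V $$ (l, j))"
      by (intro sum.cong refl arg_cong2[of _ _ _ _ "(*)"]) (auto simp: Q_def proj_compl_def algebra_simps)
    also have "\<dots> = (\<Sum>l<p. (V $$ (l, i) - w $ i * u $ l) * V $$ (l, j))"
      using ij by (simp add: sum_subtractf wi sum_distrib_right)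
    also have "\<dots> = (\<Sum>l<p. V $$ (l, i) * V $$ (l, j)) - w $ i * w $ j"
      using ij by (simp add: wi[of j] sum_distrib_left sum_subtractf algebra_simps)
    finally show "(transpose_mat V * Q * V) $$ (i, j) =
        mat p p (\<lambda>(i, j). (if i = j then 1 else 0) - w $ i * w $ j) $$ (i, j)"
      using ij Vij by simp
  qed (use V in auto)
  let ?G = "B * transpose_mat B"
  have GC: "?G \<in> carrier_mat p p" using B by auto
  have QB: "Q * B \<in> carrier_mat p q" using Q B by simp
  have e1: "(Q * B) * transpose_mat (Q * B) = Q * ?G * Q"
    using Q B by (simp add: transpose_mult[of _ p p _ q] Qt assoc_mult_mat[of _ p p _ q _ p]
        assoc_mult_mat[of _ p q _ p _ p] assoc_mult_mat[of _ p p _ p _ p])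
  have e2: "x \<cdot>\<^sub>m (Q * H * Q) = (x \<cdot>\<^sub>m (Q * H)) * Q" "Q * (x \<cdot>\<^sub>m (Q * H)) = x \<cdot>\<^sub>m ((Q * Q) * H)"
    "x \<cdot>\<^sub>m (Q * H) \<in> carrier_mat p p" if "H \<in> carrier_mat p p" for H
    using that Q by (auto simp: mult_smult_assoc_mat[of _ p p] mult_smult_distrib[of _ p p] assoc_mult_mat[of _ p p _ p _ p])
  have e3: "x \<cdot>\<^sub>m (Q * (V * D * transpose_mat V)) = (x \<cdot>\<^sub>m (Q * V * D)) * transpose_mat V"
    "transpose_mat V * (x \<cdot>\<^sub>m (Q * V * D)) = x \<cdot>\<^sub>m ((transpose_mat V * Q * V) * D)"
    "x \<cdot>\<^sub>m (Q * V * D) \<in> carrier_mat p p" if "D \<in> carrier_mat p p" for D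
    using that Q V(1) by (auto simp: mult_smult_assoc_mat[of _ p p] mult_smult_distrib[of _ p p] assoc_mult_mat[of _ p p _ p _ p])
  note e3 = e3[OF mat_diag_dim]
  have "poly (gram_poly (Q * B)) x = det (1\<^sub>m p + (x \<cdot>\<^sub>m (Q * ?G)) * Q)"
    by (simp add: poly_gram_poly[OF QB] e1 e2[OF GC])
  also have "\<dots> = det (1\<^sub>m p + x \<cdot>\<^sub>m (Q * ?G))"
    using det_one_plus_mult_commute[OF e2(3)[OF GC] Q] by (simp add: e2[OF GC] QQ)
  also have "\<dots> = det (1\<^sub>m p + x \<cdot>\<^sub>m ((transpose_mat V * Q * V) * mat_diag p d))"
    using det_one_plus_mult_commute[OF e3(3), of "transpose_mat V"] V(1) by (simp add: e3 G)
  also have "1\<^sub>m p + x \<cdot>\<^sub>m ((transpose_mat V * Q * V) * mat_diag p d) =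
      mat p p (\<lambda>(i, j). (if i = j then 1 + x * d i else 0) - x * w $ i * w $ j * d j)"
    unfolding VQV by (subst mat_diag_mult_right[of _ p p]) (auto simp: algebra_simps intro!: eq_matI)
  also have "det \<dots> = (\<Sum>l<p. (w $ l)\<^sup>2 * (\<Prod>i\<in>{..<p} - {l}. 1 + x * d i))"
  proof (rule det_diag_minus_rank_one)
    fix i assume "i < p"
    then have "0 \<le> x * d i" using d x by simp
    then show "1 + x * d i \<noteq> 0" by linarith
  qed (use ww in auto)
  finally show "poly (gram_poly (proj_compl p u * B)) x = poly (\<Sum>l<p. Polynomial.smult (((transpose_mat V *\<^sub>v u) $ l)\<^sup>2) (\<Prod>i\<in>{..<p} - {l}. [:1, d i:])) x"
    by (simp add: Q_def w_def poly_sum poly_prod)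
qed

subsection \<open>Elementary symmetric polynomials of the eigenvalues\<close>

text \<open>The recursion of elementary symmetric polynomials: subsets avoiding \<open>a\<close> and
  subsets containing \<open>a\<close>.\<close>

lemma coeff_prod_linear_insert:
  fixes d :: "'b \<Rightarrow> 'a :: comm_ring_1"
  assumes "finite S" "a \<notin> S"
  shows "coeff (\<Prod>l\<in>insert a S. [:1, d l:]) (Suc k) =
    coeff (\<Prod>l\<in>S. [:1, d l:]) (Suc k) + d a * coeff (\<Prod>l\<in>S. [:1, d l:]) k"
  using assms by (simp add: mult_pCons_left)

lemma coeff_prod_linear_0: "coeff (\<Prod>l\<in>S. [:1, d l:]) 0 = (1 :: 'a :: comm_ring_1)"
  by (simp add: poly_0_coeff_0[symmetric] poly_prod)

lemma coeff_prod_linear_nonneg: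
  fixes d :: "'b \<Rightarrow> real"
  assumes "finite S" "\<And>l. l \<in> S \<Longrightarrow> d l \<ge> 0"
  shows "coeff (\<Prod>l\<in>S. [:1, d l:]) k \<ge> 0"
  using assms
proof (induction S arbitrary: k rule: finite_induct)
  case empty
  then show ?case by (cases k) auto
next
  case (insert a S)
  then show ?case
    by (cases k) (simp_all add: coeff_prod_linear_insert coeff_prod_linear_0 del: prod.insert)
qed

text \<open>For nonnegative values e_k is positive exactly when some k of them are all
  positive.\<close>

lemma coeff_prod_linear_pos_iff:
  fixes d :: "'b \<Rightarrow> real"
  assumes "finite S" "\<And>l. l \<in> S \<Longrightarrow> d l \<ge> 0"
  shows "coeff (\<Prod>l\<in>S. [:1, d l:]) k > 0 \<longleftrightarrow> k \<le> card {l \<in> S. d l > 0}"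
  using assms
proof (induction S arbitrary: k rule: finite_induct)
  case empty
  then show ?case by (cases k) auto
next
  case (insert a S)
  show ?case
  proof (cases k)
    case 0
    then show ?thesis by (simp add: coeff_prod_linear_0 del: prod.insert)
  next
    case (Suc j)
    have IH: "coeff (\<Prod>l\<in>S. [:1, d l:]) i > 0 \<longleftrightarrow> i \<le> card {l \<in> S. d l > 0}" for i
      using insert by simp
    have nn: "coeff (\<Prod>l\<in>S. [:1, d l:]) i \<ge> 0" for i
      using insert by (intro coeff_prod_linear_nonneg) auto
    have fin: "finite {l \<in> S. d l > 0}" "a \<notin> {l \<in> S. d l > 0}" using insert by auto
    show ?thesis
    proof (cases "d a > 0")
      case True
      have "{l \<in> insert a S. d l > 0} = insert a {l \<in> S. d l > 0}" using True by auto
      then have card: "card {l \<in> insert a S. d l > 0} = Suc (card {l \<in> S. d l > 0})" using fin by simp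
      have "coeff (\<Prod>l\<in>S. [:1, d l:]) (Suc j) + d a * coeff (\<Prod>l\<in>S. [:1, d l:]) j > 0
          \<longleftrightarrow> coeff (\<Prod>l\<in>S. [:1, d l:]) j > 0"
      proof (cases "coeff (\<Prod>l\<in>S. [:1, d l:]) j > 0")
        case pos: True
        then show ?thesis using True nn[of "Suc j"] by (simp add: add_nonneg_pos)
      next
        \<comment> \<open>If e_j of \<open>S\<close> vanishes, then \<open>j\<close> exceeds the
          number of positive values, so e_(j+1) vanishes as well.\<close>
        case False
        then have "coeff (\<Prod>l\<in>S. [:1, d l:]) j = 0" "coeff (\<Prod>l\<in>S. [:1, d l:]) (Suc j) = 0"
          using nn[of j] nn[of "Suc j"] IH[of j] IH[of "Suc j"] by linarith+
        then show ?thesis by simp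
      qed
      then show ?thesis using insert Suc card IH[of j]
        by (simp add: coeff_prod_linear_insert del: prod.insert)
    next
      case False
      then have "d a = 0" using insert by force
      moreover have "{l \<in> insert a S. d l > 0} = {l \<in> S. d l > 0}" using False by auto
      ultimately show ?thesis using insert Suc IH[of "Suc j"]
        by (simp add: coeff_prod_linear_insert del: prod.insert)
    qed
  qed
qed

text \<open>Both sides are coefficient \<open>j\<close> of the derivative of the product, expanded
  by the product rule.\<close>

lemma sum_coeff_prod_linear_remove:
  fixes d :: "'b \<Rightarrow> real"
  assumes "finite S"
  shows "(\<Sum>l\<in>S. d l * coeff (\<Prod>i\<in>S - {l}. [:1, d i:]) j) = real (Suc j) * coeff (\<Prod>i\<in>S. [:1, d i:]) (Suc j)"
proof -
  have "real (Suc j) * coeff (\<Prod>i\<in>S. [:1, d i:]) (Suc j) = coeff (pderiv (\<Prod>i\<in>S. [:1, d i:])) j"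
    by (simp add: coeff_pderiv)
  also have "\<dots> = (\<Sum>l\<in>S. d l * coeff (\<Prod>i\<in>S - {l}. [:1, d i:]) j)"
    by (simp add: pderiv_prod coeff_sum pderiv_pCons mult.commute)
  finally show ?thesis by simp
qed

text \<open>Among k + 1 chosen positions the last has 0-based index at least k. Splitting it off
  bounds each product in e_(k+1) by a product from e_k times an entry of the tail. The induction
  appends at the end so that the new entry joins the tail.\<close>

lemma coeff_prod_list_linear_le:
  fixes xs :: "real list"
  assumes "\<And>x. x \<in> set xs \<Longrightarrow> x \<ge> 0"
  shows "coeff (\<Prod>x\<leftarrow>xs. [:1, x:]) (Suc k) \<le> coeff (\<Prod>x\<leftarrow>xs. [:1, x:]) k * sum_list (drop k xs)"
  using assms
proof (induction xs rule: rev_induct)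
  case Nil
  then show ?case by simp
next
  case (snoc a xs)
  let ?P = "\<Prod>x\<leftarrow>xs. [:1, x:]"
  have a: "a \<ge> 0" using snoc by simp
  have nn: "coeff (\<Prod>x\<leftarrow>ys. [:1, x:]) i \<ge> 0" if "\<And>x. x \<in> set ys \<Longrightarrow> x \<ge> 0" for ys :: "real list" and i
    using that
  proof (induction ys arbitrary: i)
    case (Cons y ys)
    then show ?case by (cases i) (auto simp: mult_pCons_left)
  qed (cases i; simp)
  have nnP: "coeff ?P i \<ge> 0" for i using nn[of xs i] snoc by simp
  have step: "coeff (\<Prod>x\<leftarrow>xs @ [a]. [:1, x:]) i = coeff ?P i + a * (if i = 0 then 0 else coeff ?P (i - 1))" for i
    by (cases i) (simp_all add: mult.commute[of ?P] mult_pCons_left)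
  have IH: "coeff ?P (Suc k) \<le> coeff ?P k * sum_list (drop k xs)" using snoc by simp
  show ?case
  proof (cases "k \<le> length xs")
    case True
    have "coeff ?P (Suc k) + a * coeff ?P k \<le> coeff ?P k * (sum_list (drop k xs) + a)"
      using IH by (simp add: algebra_simps)
    also have "\<dots> \<le> coeff (\<Prod>x\<leftarrow>xs @ [a]. [:1, x:]) k * (sum_list (drop k xs) + a)"
    proof (rule mult_right_mono)
      show "coeff ?P k \<le> coeff (\<Prod>x\<leftarrow>xs @ [a]. [:1, x:]) k"
        unfolding step using a nnP[of "k - 1"] by simp
      show "0 \<le> sum_list (drop k xs) + a"
        using a snoc by (intro add_nonneg_nonneg sum_list_nonneg) (auto dest: in_set_dropD)
    qed
    finally show ?thesis using True by (simp only: step) simp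
  next
    \<comment> \<open>Now \<open>k\<close> is at least the length of the extended list: the tail is
      empty and the coefficient lies beyond the degree.\<close>
    case False
    have "degree (\<Prod>x\<leftarrow>xs @ [a]. [:1, x:]) \<le> sum_list (map (degree \<circ> (\<lambda>x. [:1, x:])) (xs @ [a]))"
      using degree_prod_list_le[of "map (\<lambda>x. [:1, x:]) (xs @ [a])"] by (simp only: map_map)
    also have "\<dots> \<le> length (xs @ [a])"
    proof -
      have "sum_list (map (degree \<circ> (\<lambda>x. [:1, x:])) ys) \<le> length ys" for ys :: "real list"
        by (induction ys) auto
      then show ?thesis .
    qed
    also have "\<dots> < Suc k" using False by simp
    finally have "coeff (\<Prod>x\<leftarrow>xs @ [a]. [:1, x:]) (Suc k) = 0" by (rule coeff_eq_0)
    then show ?thesis using False by simp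
  qed
qed

section \<open>Averaging over the projections along single columns\<close>

lemma scalar_prod_self_real: "v \<bullet> v = (\<Sum>i<dim_vec v. (v $ i)\<^sup>2)" for v :: "real vec"
  by (simp add: scalar_prod_def atLeast0LessThan power2_eq_square)

lemma scalar_prod_self_pos: "v \<bullet> v > 0 \<longleftrightarrow> v \<noteq> 0\<^sub>v (dim_vec v)" for v :: "real vec"
proof
  assume "v \<noteq> 0\<^sub>v (dim_vec v)"
  then obtain i where "i < dim_vec v" "v $ i \<noteq> 0" by (auto simp: vec_eq_iff)
  then show "v \<bullet> v > 0" unfolding scalar_prod_self_real by (intro sum_pos2[of _ i]) auto
next
  assume "v \<bullet> v > 0"
  then show "v \<noteq> 0\<^sub>v (dim_vec v)"
    by (metis carrier_vec_dim_vec less_irrefl scalar_prod_left_zero)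
qed

lemma deflate_eq:
  assumes "B \<in> carrier_mat p q" "i < q" "col B i \<bullet> col B i > 0"
  shows "deflate B i = proj_compl p ((1 / sqrt (col B i \<bullet> col B i)) \<cdot>\<^sub>v col B i) * B"
proof -
  let ?b = "col B i"
  have "1\<^sub>m p - (1 / (?b \<bullet> ?b)) \<cdot>\<^sub>m (mat_of_cols p [?b] * mat_of_rows p [?b]) = proj_compl p ((1 / sqrt (?b \<bullet> ?b)) \<cdot>\<^sub>v ?b)"
    using assms
    by (auto simp: proj_compl_def mat_of_cols_def mat_of_rows_def scalar_prod_def[of "vec (Suc 0) _"] real_sqrt_mult[symmetric] intro!: eq_matI)
  then show ?thesis using assms by (simp add: deflate_def Let_def)
qed

text \<open>The factor in front cancels the normalization of the column, so the squared coordinates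
  of the unit vector become squared entries of V^T B.\<close>

lemma gram_poly_deflate:
  assumes B: "B \<in> carrier_mat p q" and V: "V \<in> carrier_mat p p" "transpose_mat V * V = 1\<^sub>m p" "V * transpose_mat V = 1\<^sub>m p"
    and G: "B * transpose_mat B = V * mat_diag p d * transpose_mat V"
    and d: "\<And>i. i < p \<Longrightarrow> d i \<ge> 0"
    and i: "i < q"
  shows "(col B i \<bullet> col B i) * coeff (gram_poly (deflate B i)) j =
    (\<Sum>l<p. ((transpose_mat V * B) $$ (l, i))\<^sup>2 * coeff (\<Prod>h\<in>{..<p} - {l}. [:1, d h:]) j)"
proof (cases "col B i \<bullet> col B i > 0")
  case True
  let ?b = "col B i"
  let ?c = "1 / sqrt (?b \<bullet> ?b)"
  have b: "?b \<in> carrier_vec p" using B by auto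
  have c: "?c * ?c * (?b \<bullet> ?b) = 1" using True by simp
  have u: "?c \<cdot>\<^sub>v ?b \<in> carrier_vec p" "(?c \<cdot>\<^sub>v ?b) \<bullet> (?c \<cdot>\<^sub>v ?b) = 1" using b c by auto
  have "(?b \<bullet> ?b) * ((transpose_mat V *\<^sub>v (?c \<cdot>\<^sub>v ?b)) $ l)\<^sup>2 = ((transpose_mat V * B) $$ (l, i))\<^sup>2" if "l < p" for l
  proof -
    have "(transpose_mat V *\<^sub>v (?c \<cdot>\<^sub>v ?b)) $ l = ?c * (transpose_mat V * B) $$ (l, i)"
      using that V(1) B i b by simp
    then show ?thesis using True by (simp add: power_divide)
  qed
  moreover have "gram_poly (deflate B i) = (\<Sum>l<p. Polynomial.smult (((transpose_mat V *\<^sub>v (?c \<cdot>\<^sub>v ?b)) $ l)\<^sup>2)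
      (\<Prod>h\<in>{..<p} - {l}. [:1, d h:]))"
    unfolding deflate_eq[OF B i True] by (rule gram_poly_proj_compl[OF B V G d u])
  ultimately show ?thesis
    by (simp only: coeff_sum coeff_smult sum_distrib_left)
       (intro sum.cong, auto simp: mult.assoc[symmetric])
next
  \<comment> \<open>For a zero column both sides are 0, whatever \<open>deflate B i\<close> is.
    Later sums may therefore run over all columns.\<close>
  case False
  then have "col B i = 0\<^sub>v p" using B scalar_prod_self_pos[of "col B i"] by simp
  then have "(transpose_mat V * B) $$ (l, i) = 0" if "l < p" for l
    using that V(1) B i by simp
  then show ?thesis using \<open>col B i = 0\<^sub>v p\<close> by simp
qed

text \<open>The averaging identity behind the algorithm: after exchanging the sums, the squared
  entries of row l of V^T B add up to the eigenvalue d_l, and the derivative identity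
  finishes.\<close>

lemma sum_coeff_gram_poly_deflate:
  assumes B: "B \<in> carrier_mat p q"
  shows "(\<Sum>i<q. (col B i \<bullet> col B i) * coeff (gram_poly (deflate B i)) j) =
    real (Suc j) * coeff (gram_poly B) (Suc j)"
proof -
  from gram_diagonalization[OF B] obtain V d
    where V: "V \<in> carrier_mat p p" "transpose_mat V * V = 1\<^sub>m p" "V * transpose_mat V = 1\<^sub>m p"
    and G: "B * transpose_mat B = V * mat_diag p d * transpose_mat V"
    and d: "\<And>i. i < p \<Longrightarrow> d i = (\<Sum>j<q. ((transpose_mat V * B) $$ (i, j))\<^sup>2)" by blast
  have d0: "d i \<ge> 0" if "i < p" for i using d[OF that] by (simp add: sum_nonneg)
  have "(\<Sum>i<q. (col B i \<bullet> col B i) * coeff (gram_poly (deflate B i)) j) =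
      (\<Sum>i<q. \<Sum>l<p. ((transpose_mat V * B) $$ (l, i))\<^sup>2 * coeff (\<Prod>h\<in>{..<p} - {l}. [:1, d h:]) j)"
    using gram_poly_deflate[OF B V G d0] by (intro sum.cong) auto
  also have "\<dots> = (\<Sum>l<p. d l * coeff (\<Prod>h\<in>{..<p} - {l}. [:1, d h:]) j)"
    by (subst sum.swap) (auto simp: d sum_distrib_right intro!: sum.cong)
  also have "\<dots> = real (Suc j) * coeff (gram_poly B) (Suc j)"
    by (simp only: sum_coeff_prod_linear_remove[OF finite_lessThan] gram_poly_eq_prod[OF B V(1,2) G])
  finally show ?thesis .
qed

text \<open>Keeps the denominators of the ratios positive. A nonzero column has a nonzero coordinate
  along some eigenvector with d_l > 0; dropping d_l leaves at least \<open>j\<close> positive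
  eigenvalues, so summand l in \<open>gram_poly_deflate\<close> is positive.\<close>

lemma coeff_gram_poly_deflate_pos:
  assumes B: "B \<in> carrier_mat p q" and i: "i < q" and b: "col B i \<noteq> 0\<^sub>v p"
    and pos: "coeff (gram_poly B) (Suc j) > 0"
  shows "coeff (gram_poly (deflate B i)) j > 0"
proof -
  from gram_diagonalization[OF B] obtain V d
    where V: "V \<in> carrier_mat p p" "transpose_mat V * V = 1\<^sub>m p" "V * transpose_mat V = 1\<^sub>m p"
    and G: "B * transpose_mat B = V * mat_diag p d * transpose_mat V"
    and d: "\<And>i. i < p \<Longrightarrow> d i = (\<Sum>j<q. ((transpose_mat V * B) $$ (i, j))\<^sup>2)" by blast
  have d0: "d i \<ge> 0" if "i < p" for i using d[OF that] by (simp add: sum_nonneg)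
  have bb: "col B i \<bullet> col B i > 0" using b B scalar_prod_self_pos[of "col B i"] by simp
  have "\<exists>l<p. (transpose_mat V * B) $$ (l, i) \<noteq> 0"
  proof (rule ccontr)
    assume "\<not> ?thesis"
    then have 0: "transpose_mat V *\<^sub>v col B i = 0\<^sub>v p" using V(1) B i by (auto simp: vec_eq_iff)
    have "V *\<^sub>v (transpose_mat V *\<^sub>v col B i) = 0\<^sub>v p" unfolding 0 using V(1) by auto
    moreover have "V *\<^sub>v (transpose_mat V *\<^sub>v col B i) = col B i"
      using V B by (subst assoc_mult_mat_vec[symmetric, of _ p p _ p]) auto
    ultimately show False using b by simp
  qed
  then obtain l where l: "l < p" "(transpose_mat V * B) $$ (l, i) \<noteq> 0" by blast
  have "d l > 0" unfolding d[OF l(1)] using l i by (intro sum_pos2[of _ i]) auto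
  have "Suc j \<le> card {h \<in> {..<p}. d h > 0}"
    using pos d0 coeff_prod_linear_pos_iff[of "{..<p}" d "Suc j"] by (simp add: gram_poly_eq_prod[OF B V(1,2) G])
  moreover have "{h \<in> {..<p} - {l}. d h > 0} = {h \<in> {..<p}. d h > 0} - {l}" by auto
  ultimately have "j \<le> card {h \<in> {..<p} - {l}. d h > 0}" using \<open>d l > 0\<close> l by simp
  then have 1: "coeff (\<Prod>h\<in>{..<p} - {l}. [:1, d h:]) j > 0"
    using d0 coeff_prod_linear_pos_iff[of "{..<p} - {l}" d j] by simp
  have "(\<Sum>l<p. ((transpose_mat V * B) $$ (l, i))\<^sup>2 * coeff (\<Prod>h\<in>{..<p} - {l}. [:1, d h:]) j) > 0"
    using l 1 d0 by (intro sum_pos2[of _ l]) (auto intro!: mult_nonneg_nonneg coeff_prod_linear_nonneg)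
  then have "(col B i \<bullet> col B i) * coeff (gram_poly (deflate B i)) j > 0"
    using gram_poly_deflate[OF B V G d0 i] by simp
  then show ?thesis using bb by (simp add: zero_less_mult_iff)
qed

section \<open>Links of the coefficients to norm, rank and singular values\<close>

lemma coeff_gram_poly_0:
  assumes "B \<in> carrier_mat p q"
  shows "coeff (gram_poly B) 0 = 1"
  using degree_monic_char_poly[of "- (B * transpose_mat B)" p] assms by (simp add: gram_poly_def)

lemma frobenius_norm_square:
  assumes "B \<in> carrier_mat p q"
  shows "(frobenius_norm B)\<^sup>2 = (\<Sum>i<q. col B i \<bullet> col B i)"
proof -
  have "(frobenius_norm B)\<^sup>2 = (\<Sum>i<p. \<Sum>j<q. (B $$ (i, j))\<^sup>2)"
    using assms by (simp add: frobenius_norm_def sum_nonneg)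
  also have "\<dots> = (\<Sum>i<q. col B i \<bullet> col B i)"
    using assms by (subst sum.swap) (auto simp: scalar_prod_self_real intro!: sum.cong)
  finally show ?thesis .
qed

text \<open>This is the averaging identity at index 0, where every deflated coefficient is
  1.\<close>

lemma coeff_gram_poly_1:
  assumes B: "B \<in> carrier_mat p q"
  shows "coeff (gram_poly B) 1 = (frobenius_norm B)\<^sup>2"
proof -
  have "deflate B i \<in> carrier_mat p q" for i using B by (auto simp: deflate_def Let_def)
  then show ?thesis
    using sum_coeff_gram_poly_deflate[OF B, of 0] by (simp add: coeff_gram_poly_0[of _ p q] frobenius_norm_square[OF B])
qed

text \<open>With W = V^T A, the matrix \<open>A\<close> is a sum of products of column l of
  \<open>V\<close> and row l of W. Such a product has rank at most 1 and vanishes if d_l = 0; rank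
  is subadditive.\<close>

lemma rank_le_card_eigenvalues:
  fixes A :: "real mat"
  assumes A: "A \<in> carrier_mat m n" and V: "V \<in> carrier_mat m m" "V * transpose_mat V = 1\<^sub>m m"
    and d: "\<And>i. i < m \<Longrightarrow> d i = (\<Sum>j<n. ((transpose_mat V * A) $$ (i, j))\<^sup>2)"
  shows "vec_space.rank m A \<le> card {i \<in> {..<m}. d i > 0}"
proof -
  define W where "W = transpose_mat V * A"
  have W: "W \<in> carrier_mat m n" using V A by (simp add: W_def)
  \<comment> \<open>partial sums of \<open>A = V W\<close> as a sum of matrices of rank at most one\<close>
  define P where "P s = mat m n (\<lambda>(i, j). \<Sum>l<s. V $$ (i, l) * W $$ (l, j))" for s
  have "vec_space.rank m (P s) \<le> card {i \<in> {..<s}. d i > 0}" if "s \<le> m" for s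
    using that
  proof (induction s)
    case 0
    have "P 0 = 0\<^sub>m m n" by (auto simp: P_def intro!: eq_matI)
    then show ?case using vec_space.rank_0I[of m n] by simp
  next
    case (Suc s)
    let ?Q = "mat m n (\<lambda>(i, j). V $$ (i, s) * W $$ (s, j))"
    have eq: "P (Suc s) = P s + ?Q" by (auto simp: P_def intro!: eq_matI)
    have le: "vec_space.rank m (P (Suc s)) \<le> vec_space.rank m (P s) + vec_space.rank m ?Q"
      unfolding eq by (rule vec_space.rank_subadditive) (auto simp: P_def)
    show ?case
    proof (cases "d s > 0")
      case True
      have "{i \<in> {..<Suc s}. d i > 0} = insert s {i \<in> {..<s}. d i > 0}" using True by auto
      moreover have "vec_space.rank m ?Q \<le> 1"
        by (rule vec_space.rank_le_1_product_entries[of _ m n "\<lambda>i. V $$ (i, s)" "\<lambda>j. W $$ (s, j)"]) auto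
      ultimately show ?thesis using le Suc by simp
    next
      case False
      then have "(\<Sum>j<n. (W $$ (s, j))\<^sup>2) = 0"
        using d[of s] Suc.prems by (metis W_def Suc_le_lessD less_eq_real_def sum_nonneg zero_le_power2)
      then have "W $$ (s, j) = 0" if "j < n" for j
        using that by (subst (asm) sum_nonneg_eq_0_iff) auto
      then have "?Q = 0\<^sub>m m n" by (auto intro!: eq_matI)
      then have "vec_space.rank m ?Q = 0" using vec_space.rank_0I[of m n] by simp
      moreover have "{i \<in> {..<Suc s}. d i > 0} = {i \<in> {..<s}. d i > 0}" using False by (auto simp: less_Suc_eq)
      ultimately show ?thesis using le Suc by simp
    qed
  qed
  moreover have "P m = A"
  proof -
    have "P m = V * W" using V W by (auto simp: P_def scalar_prod_def atLeast0LessThan intro!: eq_matI)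
    also have "\<dots> = (V * transpose_mat V) * A" using V(1) A by (simp add: W_def assoc_mult_mat[of _ m m _ m _ n])
    finally show ?thesis using V A by simp
  qed
  ultimately show ?thesis by (metis order_refl)
qed

lemma coeff_gram_poly_pos:
  assumes A: "A \<in> carrier_mat m n" and rank: "k \<le> vec_space.rank m A"
  shows "coeff (gram_poly A) k > 0"
proof -
  from gram_diagonalization[OF A] obtain V d
    where V: "V \<in> carrier_mat m m" "transpose_mat V * V = 1\<^sub>m m" "V * transpose_mat V = 1\<^sub>m m"
    and G: "A * transpose_mat A = V * mat_diag m d * transpose_mat V"
    and d: "\<And>i. i < m \<Longrightarrow> d i = (\<Sum>j<n. ((transpose_mat V * A) $$ (i, j))\<^sup>2)" by blast
  have d0: "d i \<ge> 0" if "i < m" for i using d[OF that] by (simp add: sum_nonneg)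
  have "k \<le> card {i \<in> {..<m}. d i > 0}"
    using rank rank_le_card_eigenvalues[OF A V(1,3) d] by simp
  then show ?thesis
    using d0 coeff_prod_linear_pos_iff[of "{..<m}" d k] by (simp add: gram_poly_eq_prod[OF A V(1,2) G])
qed

text \<open>The squared singular values are a permutation of the eigenvalues, so they give the same
  product. Their list is decreasing, which makes the tail in
  \<open>coeff_prod_list_linear_le\<close> the sum of the smallest ones.\<close>

lemma coeff_gram_poly_Suc_le:
  assumes A: "A \<in> carrier_mat m n"
  shows "coeff (gram_poly A) (Suc k) \<le> coeff (gram_poly A) k * (\<Sum>i = k + 1..m. (singular_value A i)\<^sup>2)"
proof -
  from gram_diagonalization[OF A] obtain V d
    where V: "V \<in> carrier_mat m m" "transpose_mat V * V = 1\<^sub>m m" "V * transpose_mat V = 1\<^sub>m m"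
    and G: "A * transpose_mat A = V * mat_diag m d * transpose_mat V"
    and d: "\<And>i. i < m \<Longrightarrow> d i = (\<Sum>j<n. ((transpose_mat V * A) $$ (i, j))\<^sup>2)" by blast
  have d0: "d i \<ge> 0" if "i < m" for i using d[OF that] by (simp add: sum_nonneg)
  define xs where "xs = map d [0..<m]"
  have "similar_mat (A * transpose_mat A) (mat_diag m d)"
    unfolding similar_mat_def
    by (intro exI[of _ V] exI[of _ "transpose_mat V"] similar_mat_witI[of _ _ m]) (use V G A in auto)
  then have "char_poly (A * transpose_mat A) = char_poly (mat_diag m d)" by (rule char_poly_similar)
  also have "\<dots> = (\<Prod>a\<leftarrow>diag_mat (mat_diag m d). [:- a, 1:])"
    by (rule char_poly_upper_triangular[of _ m]) (auto simp: mat_diag_def)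
  also have "diag_mat (mat_diag m d) = xs" by (auto simp: diag_mat_def mat_diag_def xs_def)
  finally have cp: "char_poly (A * transpose_mat A) = (\<Prod>a\<leftarrow>xs. [:- a, 1:])" .
  have "proots (\<Prod>a\<leftarrow>zs. [:- a, 1:]) = mset zs" for zs :: "real list"
  proof (induction zs)
    case (Cons z zs)
    have "(\<Prod>a\<leftarrow>zs. [:- a, 1:]) \<noteq> 0" by auto
    then show ?case using Cons by (simp add: proots_mult del: mult_pCons_left)
  qed simp
  then have "proots (char_poly (A * transpose_mat A)) = mset xs" by (simp add: cp)
  then have sv: "singular_values A = rev (sort (map sqrt xs))"
    by (simp add: singular_values_def sorted_list_of_multiset_mset flip: mset_map)
  define ys where "ys = map (\<lambda>x. x\<^sup>2) (singular_values A)"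
  have len: "length ys = m" by (simp add: ys_def sv xs_def)
  have "mset ys = image_mset (\<lambda>x. (sqrt x)\<^sup>2) (mset xs)" by (simp add: ys_def sv image_mset.compositionality o_def)
  also have "\<dots> = image_mset (\<lambda>x. x) (mset xs)" by (rule image_mset_cong) (auto simp: xs_def d0)
  finally have ys: "mset ys = mset xs" by simp
  have "prod_list (map (\<lambda>x. [:1, x:]) ys) = prod_list (map (\<lambda>x. [:1, x:]) xs)"
    by (metis ys mset_map prod_mset_prod_list)
  also have "\<dots> = gram_poly A"
    unfolding gram_poly_eq_prod[OF A V(1,2) G] xs_def by (simp add: prod.distinct_set_conv_list[symmetric] atLeast0LessThan comp_def)
  finally have P: "prod_list (map (\<lambda>x. [:1, x:]) ys) = gram_poly A" .
  have nn: "x \<ge> 0" if "x \<in> set ys" for x using that by (auto simp: ys_def)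
  have "sum_list (drop k ys) = (\<Sum>i = k..<m. ys ! i)"
    unfolding sum_list_sum_nth
    by (rule sum.reindex_bij_witness[of _ "\<lambda>i. i - k" "\<lambda>i. k + i"]) (auto simp: len)
  also have "\<dots> = (\<Sum>i = k..<m. (singular_values A ! i)\<^sup>2)"
    using len by (intro sum.cong) (auto simp: ys_def)
  \<comment> \<open>Shift from 0-based list positions to singular values counted from 1.\<close>
  also have "\<dots> = (\<Sum>i = k + 1..m. (singular_value A i)\<^sup>2)"
    unfolding singular_value_def
    by (rule sum.reindex_bij_witness[of _ "\<lambda>i. i - 1" "\<lambda>i. i + 1"]) auto
  finally show ?thesis using coeff_prod_list_linear_le[of ys k, OF nn] by (simp add: P)
qed

subsection \<open>Moore--Penrose inverses and orthogonal projections\<close>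

lemma mat_eq_zero_if_gram_zero:
  fixes N :: "real mat"
  assumes N: "N \<in> carrier_mat m n" and 0: "transpose_mat N * N = 0\<^sub>m n n"
  shows "N = 0\<^sub>m m n"
proof (rule eq_matI)
  fix i j assume "i < dim_row (0\<^sub>m m n :: real mat)" "j < dim_col (0\<^sub>m m n :: real mat)"
  then have ij: "i < m" "j < n" by auto
  have "col N j \<bullet> col N j = 0"
    using arg_cong[OF 0, of "\<lambda>M. M $$ (j, j)"] ij N by simp
  then have "col N j = 0\<^sub>v m" using scalar_prod_self_pos[of "col N j"] N by force
  then show "N $$ (i, j) = 0\<^sub>m m n $$ (i, j)"
    using arg_cong[of _ _ "\<lambda>v. v $ i"] ij N by (metis carrier_matD index_col index_zero_mat(1) index_zero_vec(1))
qed (use N in auto)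

text \<open>The witness is H A^T with H a pseudoinverse of G = A^T A built from its diagonalization.
  Apart from symmetry, everything rests on A H G = A.\<close>

lemma moore_penrose_exists: "\<exists>X. is_moore_penrose A X"
proof -
  define m n where "m = dim_row A" and "n = dim_col A"
  have A: "A \<in> carrier_mat m n" by (simp add: m_def n_def)
  then have At: "transpose_mat A \<in> carrier_mat n m" by simp
  define G where "G = transpose_mat A * A"
  have G: "G \<in> carrier_mat n n" using A by (simp add: G_def)
  obtain V d where V: "V \<in> carrier_mat n n" "transpose_mat V * V = 1\<^sub>m n"
    and GV: "G = V * mat_diag n d * transpose_mat V"
    using gram_diagonalization[OF At] A unfolding G_def by (metis transpose_transpose)
  define K where "K f = V * mat_diag n f * transpose_mat V" for f
  have K: "K f \<in> carrier_mat n n" for f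
    unfolding K_def using V(1) by (meson mat_diag_dim mult_carrier_mat transpose_carrier_mat)
  have KK: "K f * K g = K (\<lambda>i. f i * g i)" for f g
  proof -
    have "(V * D * transpose_mat V) * (V * E * transpose_mat V) = V * (D * ((transpose_mat V * V) * E)) * transpose_mat V"
      if "D \<in> carrier_mat n n" "E \<in> carrier_mat n n" for D E
      using that V(1) by (simp add: assoc_mult_mat[of _ n n _ n _ n])
    from this[of "mat_diag n f" "mat_diag n g"] show ?thesis
      by (simp add: K_def V(2) left_mult_one_mat[OF mat_diag_dim])
  qed
  have Kt: "transpose_mat (K f) = K f" for f
  proof -
    have D: "transpose_mat (mat_diag n f) = mat_diag n f" by (auto simp: mat_diag_def intro!: eq_matI)
    have "transpose_mat (V * D * transpose_mat V) = V * transpose_mat D * transpose_mat V"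
      if "D \<in> carrier_mat n n" for D
      using that V(1) by (simp add: transpose_mult[of _ n n _ n] assoc_mult_mat[of _ n n _ n _ n])
    from this[of "mat_diag n f"] show ?thesis by (simp add: K_def D)
  qed
  have GK: "G = K d" by (simp add: GV K_def)
  \<comment> \<open>\<open>H\<close> is the pseudoinverse of \<open>G\<close>, since \<open>inverse 0 = 0\<close>\<close>
  define H where "H = K (\<lambda>i. inverse (d i))"
  have H: "H \<in> carrier_mat n n" by (simp add: H_def K)
  have Ht: "transpose_mat H = H" by (simp add: H_def Kt)
  have GHG: "G * (H * G) = G"
    by (simp add: H_def GK KK) (rule arg_cong[of _ _ K], auto simp: field_simps)
  have HGH: "H * G * H = H"
    by (simp add: H_def GK KK) (rule arg_cong[of _ _ K], auto simp: field_simps)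
  have HGt: "transpose_mat (H * G) = H * G" by (simp add: H_def GK KK Kt)
  define E where "E = H * G"
  have E: "E \<in> carrier_mat n n" using H G by (simp add: E_def)
  \<comment> \<open>\<open>N\<close> vanishes because its Gram matrix does, which follows from G H G
    = G.\<close>
  define N where "N = A - A * E"
  have N: "N \<in> carrier_mat m n" using minus_carrier_mat[OF mult_carrier_mat[OF A E]] by (simp add: N_def)
  have "transpose_mat N = transpose_mat A - E * transpose_mat A"
    using A E HGt by (simp add: N_def E_def transpose_minus[of _ m n] transpose_mult[of _ m n _ n])
  then have "transpose_mat N * N = (transpose_mat A - E * transpose_mat A) * (A - A * E)"
    by (simp add: N_def)
  also have "\<dots> = (transpose_mat A * A - transpose_mat A * (A * E)) -
      (E * transpose_mat A * A - E * transpose_mat A * (A * E))"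
  proof -
    have "(X - Y) * (A - Z) = (X * A - X * Z) - (Y * A - Y * Z)"
      if "X \<in> carrier_mat n m" "Y \<in> carrier_mat n m" "Z \<in> carrier_mat m n" for X Y Z
      using that A minus_carrier_mat[OF that(3), of A]
      by (simp add: minus_mult_distrib_mat[of _ n m _ _ n] mult_minus_distrib_mat[of _ n m _ n])
    then show ?thesis using A E by simp
  qed
  also have "\<dots> = (G - G * E) - (E * G - E * (G * E))"
    using A E unfolding G_def
    by (simp add: assoc_mult_mat[of _ n n _ m _ n] assoc_mult_mat[of _ n m _ n _ n])
  also have "\<dots> = 0\<^sub>m n n"
    unfolding GHG[folded E_def] using G E by (intro eq_matI) auto
  finally have N0: "A - A * E = 0\<^sub>m m n" using mat_eq_zero_if_gram_zero[OF N] by (simp add: N_def)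
  have AE: "A * E = A"
  proof (rule eq_matI)
    fix i j assume "i < dim_row A" "j < dim_col A"
    then show "(A * E) $$ (i, j) = A $$ (i, j)"
      using arg_cong[OF N0, of "\<lambda>M. M $$ (i, j)"] A E by simp
  qed (use A E in auto)
  let ?X = "H * transpose_mat A"
  have X: "?X \<in> carrier_mat n m" using H A by simp
  have XA: "?X * A = E" using H A by (simp add: E_def G_def assoc_mult_mat[of _ n n _ m _ n])
  have "A * ?X * A = A"
    using A X AE by (simp add: assoc_mult_mat[of _ m n _ m _ n] XA)
  moreover have "?X * A * ?X = ?X"
    unfolding XA using HGH H A E by (simp add: assoc_mult_mat[of _ n n _ n _ m, symmetric] E_def)
  moreover have "transpose_mat (A * ?X) = A * ?X"
    using A H X by (simp add: transpose_mult[of _ m n _ m] transpose_mult[of _ n n _ m] Ht assoc_mult_mat[of _ m n _ n _ m])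
  moreover have "transpose_mat (?X * A) = ?X * A" unfolding XA by (simp add: E_def HGt)
  ultimately show ?thesis using X unfolding is_moore_penrose_def m_def n_def by blast
qed

lemma moore_penrose: "is_moore_penrose A (moore_penrose A)"
  unfolding moore_penrose_def
  by (rule theI') (use moore_penrose_exists is_moore_penrose_unique in blast)

lemma moore_penrose_carrier:
  assumes "A \<in> carrier_mat m n"
  shows "moore_penrose A \<in> carrier_mat n m"
  using moore_penrose[of A] assms by (auto simp: is_moore_penrose_def)

text \<open>Needed to read the error of the row selection as a column selection error of the
  transpose.\<close>

lemma moore_penrose_transpose: "moore_penrose (transpose_mat A) = transpose_mat (moore_penrose A)"
proof -
  define m n where "m = dim_row A" and "n = dim_col A"
  have A: "A \<in> carrier_mat m n" by (simp add: m_def n_def)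
  let ?X = "moore_penrose A"
  have X: "?X \<in> carrier_mat n m" using moore_penrose_carrier[OF A] .
  have mp: "A * ?X * A = A" "?X * A * ?X = ?X" "transpose_mat (A * ?X) = A * ?X" "transpose_mat (?X * A) = ?X * A"
    using moore_penrose[of A] by (auto simp: is_moore_penrose_def)
  have AX: "transpose_mat ?X * transpose_mat A = transpose_mat (A * ?X)"
    and XA: "transpose_mat A * transpose_mat ?X = transpose_mat (?X * A)"
    using A X by (simp_all add: transpose_mult)
  have "transpose_mat A * transpose_mat ?X * transpose_mat A = transpose_mat (A * (?X * A))"
    unfolding XA using transpose_mult[OF A mult_carrier_mat[OF X A]] by simp
  moreover have "A * (?X * A) = A" using A X mp(1) by (simp add: assoc_mult_mat[of _ m n _ m _ n])
  moreover have "transpose_mat ?X * transpose_mat A * transpose_mat ?X = transpose_mat (?X * (A * ?X))"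
    unfolding AX using transpose_mult[OF X mult_carrier_mat[OF A X]] by simp
  moreover have "?X * (A * ?X) = ?X" using A X mp(2) by (simp add: assoc_mult_mat[of _ n m _ n _ m])
  ultimately have "is_moore_penrose (transpose_mat A) (transpose_mat ?X)"
    using A X by (simp add: is_moore_penrose_def AX XA mp)
  then show ?thesis using moore_penrose is_moore_penrose_unique by blast
qed

text \<open>Together these facts make the product the orthogonal projection onto the column space of
  \<open>A\<close>.\<close>

lemma range_projection:
  assumes A: "A \<in> carrier_mat m n"
  shows "A * moore_penrose A \<in> carrier_mat m m"
    and "transpose_mat (A * moore_penrose A) = A * moore_penrose A"
    and "A * moore_penrose A * A = A"
    and "A * moore_penrose A * (A * moore_penrose A) = A * moore_penrose A"
proof -
  have X: "moore_penrose A \<in> carrier_mat n m" using moore_penrose_carrier[OF A] .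
  then show 1: "A * moore_penrose A \<in> carrier_mat m m" using A by simp
  show "transpose_mat (A * moore_penrose A) = A * moore_penrose A" and 2: "A * moore_penrose A * A = A"
    using moore_penrose[of A] by (auto simp: is_moore_penrose_def)
  show "A * moore_penrose A * (A * moore_penrose A) = A * moore_penrose A"
    using assoc_mult_mat[OF 1 A X] by (simp only: 2)
qed

section \<open>Residuals of selected columns\<close>

lemma select_cols_carrier:
  assumes "M \<in> carrier_mat p q"
  shows "select_cols M S \<in> carrier_mat p (length S)"
  using mat_of_cols_carrier(1)[of p "map (col M) S"] assms by (simp add: select_cols_def)

lemma mult_select_cols_fixed_iff:
  assumes M: "M \<in> carrier_mat p q" and K: "K \<in> carrier_mat p p"
  shows "K * select_cols M S = select_cols M S \<longleftrightarrow> (\<forall>s\<in>set S. K *\<^sub>v col M s = col M s)"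
proof -
  have C: "select_cols M S \<in> carrier_mat p (length S)" using select_cols_carrier[OF M] .
  have col: "col (select_cols M S) j = col M (S ! j)" if "j < length S" for j
    using that M col_dim[of M "S ! j"] by (simp add: select_cols_def)
  have KC: "col (K * select_cols M S) j = K *\<^sub>v col M (S ! j)" if "j < length S" for j
    using col_mult2[OF K C that] col[OF that] by simp
  show ?thesis
  proof
    assume "K * select_cols M S = select_cols M S"
    then show "\<forall>s\<in>set S. K *\<^sub>v col M s = col M s" using KC col by (metis in_set_conv_nth)
  next
    assume *: "\<forall>s\<in>set S. K *\<^sub>v col M s = col M s"
    show "K * select_cols M S = select_cols M S"
    proof (rule mat_col_eqI)
      fix j assume "j < dim_col (select_cols M S)"
      then have "j < length S" using C by simp
      then show "col (K * select_cols M S) j = col (select_cols M S) j" using * KC col by simp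
    qed (use K C in auto)
  qed
qed

text \<open>A Gram-Schmidt step: the residual recomputed by the algorithm is the matrix whose ratio
  was just minimized. The new projection is \<open>P' = P + T\<close>, where \<open>T\<close>
  projects onto the normalized residual column \<open>u\<close>, orthogonal to the range of
  \<open>P\<close>.\<close>

lemma residual_append:
  assumes M: "M \<in> carrier_mat p q" and i: "i < q"
    and B: "B = M - select_cols M S * moore_penrose (select_cols M S) * M"
    and b: "col B i \<noteq> 0\<^sub>v p"
  shows "M - select_cols M (S @ [i]) * moore_penrose (select_cols M (S @ [i])) * M = deflate B i"
proof -
  define C C' where "C = select_cols M S" and "C' = select_cols M (S @ [i])"
  define P P' where "P = C * moore_penrose C" and "P' = C' * moore_penrose C'"
  have C: "C \<in> carrier_mat p (length S)" and C': "C' \<in> carrier_mat p (length (S @ [i]))"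
    unfolding C_def C'_def by (rule select_cols_carrier[OF M])+
  note P = range_projection[OF C, folded P_def] and P' = range_projection[OF C', folded P'_def]
  have X: "moore_penrose C \<in> carrier_mat (length S) p" by (rule moore_penrose_carrier[OF C])
  have X': "moore_penrose C' \<in> carrier_mat (length (S @ [i])) p" by (rule moore_penrose_carrier[OF C'])
  have mc: "col M s \<in> carrier_vec p" for s using M by auto
  have Pm: "P *\<^sub>v col M s = col M s" if "s \<in> set S" for s
    using mult_select_cols_fixed_iff[OF M P(1), of S] P(3) that by (simp add: C_def)
  have P'm: "P' *\<^sub>v col M s = col M s" if "s \<in> set (S @ [i])" for s
    using mult_select_cols_fixed_iff[OF M P'(1), of "S @ [i]"] P'(3) that by (auto simp: C'_def)
  have Bc: "B \<in> carrier_mat p q" using minus_carrier_mat[OF mult_carrier_mat[OF P(1) M]] by (simp add: B C_def[symmetric] P_def[symmetric])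
  define bb where "bb = col B i"
  have bM: "bb = col M i - P *\<^sub>v col M i"
    unfolding bb_def B C_def[symmetric] P_def[symmetric] using M P(1) i by (intro eq_vecI) auto
  have bc: "bb \<in> carrier_vec p" using Bc col_dim[of B i] by (simp add: bb_def)
  have pos: "bb \<bullet> bb > 0" using b scalar_prod_self_pos[of bb] carrier_vecD[OF bc] by (simp add: bb_def)
  have PPm: "P *\<^sub>v (P *\<^sub>v col M i) = P *\<^sub>v col M i"
    using P(1,4) mc by (simp add: assoc_mult_mat_vec[symmetric, of _ p p _ p])
  have Pb: "P *\<^sub>v bb = 0\<^sub>v p"
    using P(1) mc by (simp add: bM mult_minus_distrib_mat_vec[of _ p p] PPm)
  define c where "c = 1 / sqrt (bb \<bullet> bb)"
  define u where "u = c \<cdot>\<^sub>v bb"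
  have cc: "c * c * (bb \<bullet> bb) = 1" using pos by (simp add: c_def)
  have u: "u \<in> carrier_vec p" using bc by (simp add: u_def)
  have smult_0: "x \<cdot>\<^sub>v 0\<^sub>v p = 0\<^sub>v p" for x :: real by auto
  have Pu: "P *\<^sub>v u = 0\<^sub>v p" using P(1) bc by (simp add: u_def mult_mat_vec Pb smult_0)
  have P'P: "P' * P = P"
  proof -
    have "P' * C = C" using mult_select_cols_fixed_iff[OF M P'(1), of S] P'm by (simp add: C_def)
    then show ?thesis using assoc_mult_mat[OF P'(1) C X] by (simp add: P_def)
  qed
  have P'b: "P' *\<^sub>v bb = bb"
    using P(1) P'(1) mc P'm[of i]
    by (simp add: bM mult_minus_distrib_mat_vec[of _ p p] assoc_mult_mat_vec[symmetric, of _ p p _ p] P'P)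
  define T where "T = mat p p (\<lambda>(i, j). u $ i * u $ j)"
  have T: "T \<in> carrier_mat p p" by (simp add: T_def)
  have Tt: "transpose_mat T = T" by (auto simp: T_def intro!: eq_matI)
  have colT: "col T j = u $ j \<cdot>\<^sub>v u" if "j < p" for j
    using that u by (auto simp: T_def intro!: eq_vecI)
  have Tv: "T *\<^sub>v v = (u \<bullet> v) \<cdot>\<^sub>v u" if "v \<in> carrier_vec p" for v
    using that u by (auto simp: T_def scalar_prod_def sum_distrib_right sum_distrib_left mult_ac intro!: eq_vecI sum.cong)
  have P'T: "P' * T = T"
  proof (rule mat_col_eqI)
    fix j assume "j < dim_col T"
    then have j: "j < p" using T by simp
    have "P' *\<^sub>v u = u" using P'(1) bc by (simp add: u_def mult_mat_vec P'b)
    then show "col (P' * T) j = col T j"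
      using col_mult2[OF P'(1) T j] P'(1) u by (simp add: colT[OF j] mult_mat_vec)
  qed (use P'(1) T in auto)
  have PT: "P * T = 0\<^sub>m p p"
  proof (rule mat_col_eqI)
    fix j assume "j < dim_col (0\<^sub>m p p :: real mat)"
    then have j: "j < p" by simp
    then show "col (P * T) j = col (0\<^sub>m p p) j"
      using col_mult2[OF P(1) T j] P(1) u by (simp add: colT[OF j] mult_mat_vec Pu smult_0)
  qed (use P(1) T in auto)
  have TP: "T * P = 0\<^sub>m p p"
    using arg_cong[OF PT, of transpose_mat] P(1,2) T Tt by (simp add: transpose_mult[of _ p p _ p])
  \<comment> \<open>Earlier columns lie in the range of \<open>P\<close> and are annihilated by
    \<open>T\<close>; the new column is \<open>bb\<close> plus its projection, and \<open>T\<close>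
    returns \<open>bb\<close>.\<close>
  have PTm: "(P + T) *\<^sub>v col M s = col M s" if s: "s \<in> set (S @ [i])" for s
  proof (cases "s \<in> set S")
    case True
    have "u \<bullet> col M s = (P *\<^sub>v u) \<bullet> col M s"
      using symmetric_scalar_prod[OF P(1,2) u mc, of s] Pm[OF True] by simp
    then have "u \<bullet> col M s = 0" using mc Pu by simp
    then have "T *\<^sub>v col M s = 0\<^sub>v p" using Tv[OF mc] u by auto
    then show ?thesis using P(1) T mc[of s]
      by (simp add: add_mult_distrib_mat_vec[of _ p p] Pm[OF True])
  next
    case False
    then have s: "s = i" using that by simp
    have m: "col M i = bb + P *\<^sub>v col M i" using P(1) M by (auto simp: bM intro!: eq_vecI)
    have "u \<bullet> (P *\<^sub>v col M i) = 0"
      using symmetric_scalar_prod[OF P(1,2) u mc, of i] mc Pu by simp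
    moreover have "u \<bullet> col M i = u \<bullet> bb + u \<bullet> (P *\<^sub>v col M i)"
      using u bc P(1) mc[of i] by (subst m) (simp add: scalar_prod_add_distrib[of _ p])
    ultimately have "(u \<bullet> col M i) \<cdot>\<^sub>v u = (c * c * (bb \<bullet> bb)) \<cdot>\<^sub>v bb"
      using bc by (simp add: u_def smult_smult_assoc mult_ac)
    then have "T *\<^sub>v col M i = bb" using Tv[OF mc] cc by simp
    then have "(P + T) *\<^sub>v col M i = P *\<^sub>v col M i + bb"
      using P(1) T mc[of i] by (simp add: add_mult_distrib_mat_vec[of _ p p])
    also have "\<dots> = col M i" using P(1) M by (auto simp: bM intro!: eq_vecI)
    finally show ?thesis using s by simp
  qed
  have PTc: "P + T \<in> carrier_mat p p" using T by simp
  have "(P + T) * C' = C'" using mult_select_cols_fixed_iff[OF M PTc, of "S @ [i]"] PTm by (simp add: C'_def)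
  then have 1: "(P + T) * P' = P'" using assoc_mult_mat[OF PTc C' X'] by (simp add: P'_def)
  have "transpose_mat (P + T) = P + T" using P T Tt by (simp add: transpose_add[of _ p p])
  then have "P' * (P + T) = P'"
    using arg_cong[OF 1, of transpose_mat] P'(1,2) PTc by (simp add: transpose_mult[of _ p p _ p])
  \<comment> \<open>The product \<open>P' * (P + T)\<close> equals \<open>P'\<close> as just shown,
    and equals \<open>P + T\<close> because \<open>P'\<close> fixes both summands.\<close>
  then have P'eq: "P' = P + T"
    using P'(1) P(1) T by (simp add: mult_add_distrib_mat[of _ p p] P'P P'T)
  have "proj_compl p u = 1\<^sub>m p - T" by (auto simp: proj_compl_def T_def intro!: eq_matI)
  then have "deflate B i = (1\<^sub>m p - T) * (M - P * M)"
    using deflate_eq[OF Bc i] pos by (simp add: bb_def[symmetric] c_def[symmetric] u_def[symmetric])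
      (simp add: B C_def P_def)
  also have "\<dots> = (M - P * M) - (T * M - (T * P) * M)"
    using P(1) T M minus_carrier_mat[OF mult_carrier_mat[OF P(1) M], of M]
    by (simp add: minus_mult_distrib_mat[of _ p p _ _ q] mult_minus_distrib_mat[of _ p p _ q] assoc_mult_mat[of _ p p _ p _ q])
  also have "\<dots> = M - (P + T) * M"
    using P(1) T M by (auto simp: TP add_mult_distrib_mat[of _ p p] intro!: eq_matI)
  finally show ?thesis by (simp add: P'eq[symmetric] P'_def C'_def)
qed

subsection \<open>Analysis of the algorithm\<close>

text \<open>Here \<open>t\<close> counts the completed passes, so the current pass is number
  \<open>Suc t\<close>. The bounds on \<open>t\<close> and \<open>k\<close> keep the truncated
  subtractions exact.\<close>

lemma css_ratio_eq:
  assumes B: "B \<in> carrier_mat p q" and "t < k" "k \<le> p"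
  shows "css_ratio k (Suc t) B i =
    coeff (gram_poly (deflate B i)) (k - t) / coeff (gram_poly (deflate B i)) (k - Suc t)"
proof -
  have D: "deflate B i \<in> carrier_mat p q" using B by (auto simp: deflate_def Let_def)
  have "p - k + Suc t - 1 = p - (k - t)" "p - k + Suc t = p - (k - Suc t)" using assms by auto
  then show ?thesis
    using B det_coeff_gram_poly[OF D, of "k - t"] det_coeff_gram_poly[OF D, of "k - Suc t"] assms
    by (simp add: css_ratio_def Let_def)
qed

text \<open>A minimum is at most a weighted mean: with weights ||b_i||^2 e_j(B_i), the averaging
  identity evaluates numerator and denominator at j + 1 and j.\<close>

lemma min_ratio_le:
  assumes B: "B \<in> carrier_mat p q" and pos: "coeff (gram_poly B) (Suc j) > 0"
    and r: "\<And>i. i < q \<Longrightarrow> col B i \<noteq> 0\<^sub>v p \<Longrightarrow>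
      r \<le> coeff (gram_poly (deflate B i)) (Suc j) / coeff (gram_poly (deflate B i)) j"
  shows "real (Suc j) * r \<le> real (Suc (Suc j)) * (coeff (gram_poly B) (Suc (Suc j)) / coeff (gram_poly B) (Suc j))"
proof -
  have "r * (real (Suc j) * coeff (gram_poly B) (Suc j)) =
      (\<Sum>i<q. (col B i \<bullet> col B i) * (r * coeff (gram_poly (deflate B i)) j))"
    unfolding sum_coeff_gram_poly_deflate[OF B, symmetric] sum_distrib_left
    by (intro sum.cong) auto
  also have "\<dots> \<le> (\<Sum>i<q. (col B i \<bullet> col B i) * coeff (gram_poly (deflate B i)) (Suc j))"
  proof (rule sum_mono)
    fix i assume i: "i \<in> {..<q}"
    show "(col B i \<bullet> col B i) * (r * coeff (gram_poly (deflate B i)) j)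
        \<le> (col B i \<bullet> col B i) * coeff (gram_poly (deflate B i)) (Suc j)"
    proof (cases "col B i = 0\<^sub>v p")
      case False
      have "coeff (gram_poly (deflate B i)) j > 0"
        using coeff_gram_poly_deflate_pos[OF B _ False pos] i by simp
      then have "r * coeff (gram_poly (deflate B i)) j \<le> coeff (gram_poly (deflate B i)) (Suc j)"
        using r[OF _ False] i by (simp add: pos_le_divide_eq)
      moreover have "col B i \<bullet> col B i \<ge> 0" by (simp add: scalar_prod_self_real sum_nonneg)
      ultimately show ?thesis by (rule mult_left_mono)
    qed simp
  qed
  also have "\<dots> = real (Suc (Suc j)) * coeff (gram_poly B) (Suc (Suc j))"
    by (rule sum_coeff_gram_poly_deflate[OF B])
  finally show ?thesis using pos by (simp add: pos_le_divide_eq mult_ac)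
qed

text \<open>Loop invariant: the potential (j + 1) e_(j+1) / e_j at \<open>j = k - length S\<close>
  stays below its initial value, and its denominator stays positive.\<close>

lemma css_state_bound:
  assumes M: "M \<in> carrier_mat p q" and k: "k \<le> p" and pos: "coeff (gram_poly M) k > 0"
    and state: "css_state M k S B"
  shows "B = M - select_cols M S * moore_penrose (select_cols M S) * M \<and> set S \<subseteq> {..<q} \<and> length S \<le> k \<and>
    coeff (gram_poly B) (k - length S) > 0 \<and>
    real (Suc (k - length S)) * (coeff (gram_poly B) (Suc (k - length S)) / coeff (gram_poly B) (k - length S))
      \<le> real (Suc k) * (coeff (gram_poly M) (Suc k) / coeff (gram_poly M) k)"
  using state
proof (induction rule: css_state.induct)
  case init
  \<comment> \<open>The product over an empty inner dimension is the zero matrix, so the initial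
    \<open>B = M\<close> has residual form.\<close>
  have C: "select_cols M [] \<in> carrier_mat p 0" using select_cols_carrier[OF M, of "[]"] by simp
  have "M - select_cols M [] * moore_penrose (select_cols M []) * M = M"
    using C moore_penrose_carrier[OF C] M by (intro eq_matI) (auto simp: scalar_prod_def)
  then show ?case using pos by simp
next
  case (step S B i)
  define j where "j = k - Suc (length S)"
  have j: "k - length S = Suc j" "k - length (S @ [i]) = j" using step.hyps(2) by (auto simp: j_def)
  have B: "B = M - select_cols M S * moore_penrose (select_cols M S) * M" and S: "set S \<subseteq> {..<q}"
    and posB: "coeff (gram_poly B) (Suc j) > 0"
    and IH: "real (Suc (Suc j)) * (coeff (gram_poly B) (Suc (Suc j)) / coeff (gram_poly B) (Suc j))
      \<le> real (Suc k) * (coeff (gram_poly M) (Suc k) / coeff (gram_poly M) k)"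
    using step.IH j by auto
  have Bc: "B \<in> carrier_mat p q"
    unfolding B by (rule minus_carrier_mat[OF mult_carrier_mat[OF range_projection(1)[OF select_cols_carrier[OF M]] M]])
  have i: "i < q" "col B i \<noteq> 0\<^sub>v p"
    using step.hyps(3) M Bc by (auto simp: is_arg_min_def)
  have ratio: "css_ratio k (length S + 1) B h =
      coeff (gram_poly (deflate B h)) (Suc j) / coeff (gram_poly (deflate B h)) j" for h
    using css_ratio_eq[OF Bc step.hyps(2) k, of h] j by simp
  have "css_ratio k (length S + 1) B i \<le> css_ratio k (length S + 1) B h" if "h < q" "col B h \<noteq> 0\<^sub>v p" for h
    using step.hyps(3) M Bc that unfolding is_arg_min_def by (metis carrier_matD leI)
  then have "real (Suc j) * css_ratio k (length S + 1) B i \<le>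
      real (Suc (Suc j)) * (coeff (gram_poly B) (Suc (Suc j)) / coeff (gram_poly B) (Suc j))"
    unfolding ratio by (intro min_ratio_le[OF Bc posB]) auto
  \<comment> \<open>By \<open>residual_append\<close> the minimal ratio is e_(j+1) / e_j of the new
    residual, so the previous inequality chains with \<open>IH\<close>.\<close>
  then show ?case
    unfolding residual_append[OF M i(1) B i(2)] j(2)
    using IH coeff_gram_poly_deflate_pos[OF Bc i posB] residual_append[OF M i(1) B i(2)] S i(1) step.hyps(2)
    unfolding ratio by auto
qed

text \<open>After \<open>k\<close> passes the index is 0 and the potential is e_1 / e_0, the squared
  Frobenius norm of the residual.\<close>

lemma css_output_bound:
  assumes M: "M \<in> carrier_mat p q" and k: "k \<le> p" and pos: "coeff (gram_poly M) k > 0"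
    and out: "css_output M k S"
  shows "set S \<subseteq> {..<q}"
    and "(frobenius_norm (M - select_cols M S * moore_penrose (select_cols M S) * M))\<^sup>2
      \<le> real (Suc k) * (coeff (gram_poly M) (Suc k) / coeff (gram_poly M) k)"
proof -
  obtain B where state: "css_state M k S B" and len: "length S = k"
    using out by (auto simp: css_output_def)
  note * = css_state_bound[OF M k pos state]
  then show "set S \<subseteq> {..<q}" by blast
  have B: "M - select_cols M S * moore_penrose (select_cols M S) * M \<in> carrier_mat p q"
    by (rule minus_carrier_mat[OF mult_carrier_mat[OF range_projection(1)[OF select_cols_carrier[OF M]] M]])
  show "(frobenius_norm (M - select_cols M S * moore_penrose (select_cols M S) * M))\<^sup>2
      \<le> real (Suc k) * (coeff (gram_poly M) (Suc k) / coeff (gram_poly M) k)"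
    using * len coeff_gram_poly_0[OF B] coeff_gram_poly_1[OF B] by auto
qed

section \<open>Pythagoras for projections and the final estimate\<close>

lemma frobenius_norm_transpose: "frobenius_norm (transpose_mat A) = frobenius_norm A"
proof -
  have "(\<Sum>i<dim_col A. \<Sum>j<dim_row A. (transpose_mat A $$ (i, j))\<^sup>2) =
      (\<Sum>i<dim_col A. \<Sum>j<dim_row A. (A $$ (j, i))\<^sup>2)"
    by (intro sum.cong) auto
  then show ?thesis using sum.swap[of "\<lambda>i j. (A $$ (i, j))\<^sup>2" "{..<dim_col A}" "{..<dim_row A}"]
    by (simp add: frobenius_norm_def)
qed

lemma frobenius_norm_nonneg: "frobenius_norm A \<ge> 0"
  by (simp add: frobenius_norm_def sum_nonneg)

text \<open>Pythagoras for each column v: symmetry and idempotence of \<open>P\<close> give v . Pv =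
  Pv . Pv.\<close>

lemma frobenius_norm_projection:
  assumes P: "P \<in> carrier_mat m m" "transpose_mat P = P" "P * P = P" and Y: "Y \<in> carrier_mat m n"
  shows "(frobenius_norm Y)\<^sup>2 = (frobenius_norm (Y - P * Y))\<^sup>2 + (frobenius_norm (P * Y))\<^sup>2"
proof -
  have PY: "P * Y \<in> carrier_mat m n" using P Y by simp
  have *: "col Y i \<bullet> col Y i = col (Y - P * Y) i \<bullet> col (Y - P * Y) i + col (P * Y) i \<bullet> col (P * Y) i" if i: "i < n" for i
  proof -
    define v where "v = col Y i"
    define w where "w = P *\<^sub>v v"
    have v: "v \<in> carrier_vec m" using Y i by (auto simp: v_def)
    have w: "w \<in> carrier_vec m" unfolding w_def by (rule mult_mat_vec_carrier[OF P(1) v])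
    have "col (P * Y) i = w" unfolding v_def w_def by (rule col_mult2[OF P(1) Y i])
    moreover have "col (Y - P * Y) i = v - w"
      unfolding v_def w_def using P(1) Y i by (intro eq_vecI) auto
    ultimately have cols: "col (P * Y) i = w" "col (Y - P * Y) i = v - w" .
    have "P *\<^sub>v w = w" using assoc_mult_mat_vec[OF P(1) P(1) v] P(3) by (simp add: w_def)
    then have "v \<bullet> w = w \<bullet> w"
      using symmetric_scalar_prod[OF P(1,2) v w] by (simp add: w_def)
    moreover have "w \<bullet> v = v \<bullet> w" using v w by (rule comm_scalar_prod[symmetric])
    moreover have "(v - w) \<bullet> (v - w) = v \<bullet> v - v \<bullet> w - (w \<bullet> v - w \<bullet> w)"
      using v w minus_carrier_vec[OF v w]
      by (simp only: minus_scalar_prod_distrib[of v m w] scalar_prod_minus_distrib[of _ m v w])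
    ultimately show ?thesis unfolding cols v_def[symmetric] by linarith
  qed
  show ?thesis
    unfolding frobenius_norm_square[OF Y] frobenius_norm_square[OF minus_carrier_mat[OF PY]]
      frobenius_norm_square[OF PY] sum.distrib[symmetric]
    by (rule sum.cong) (simp_all only: lessThan_iff *)
qed

text \<open>Split A - PAQ into A - PA and P(A - AQ). The parts are orthogonal, and \<open>P\<close>
  does not increase the norm of the second.\<close>

lemma frobenius_norm_two_sided_projection_le:
  assumes P: "P \<in> carrier_mat m m" "transpose_mat P = P" "P * P = P"
    and Q: "Q \<in> carrier_mat n n" and A: "A \<in> carrier_mat m n"
  shows "(frobenius_norm (A - P * A * Q))\<^sup>2 \<le> (frobenius_norm (A - P * A))\<^sup>2 + (frobenius_norm (A - A * Q))\<^sup>2"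
proof -
  have PA: "P * A \<in> carrier_mat m n" and AQ: "A * Q \<in> carrier_mat m n" and PAQ: "P * A * Q \<in> carrier_mat m n"
    using P Q A by auto
  have 1: "P * (A - P * A * Q) = P * (A - A * Q)"
  proof -
    have "P * (P * A * Q) = P * (P * (A * Q))" by (simp only: assoc_mult_mat[OF P(1) A Q])
    also have "\<dots> = P * P * (A * Q)" by (rule assoc_mult_mat[OF P(1) P(1) AQ, symmetric])
    finally have "P * (P * A * Q) = P * (A * Q)" by (simp only: P(3))
    then show ?thesis unfolding mult_minus_distrib_mat[OF P(1) A AQ] mult_minus_distrib_mat[OF P(1) A PAQ] by simp
  qed
  have "P * (A - A * Q) = P * A - P * A * Q"
    unfolding mult_minus_distrib_mat[OF P(1) A AQ] assoc_mult_mat[OF P(1) A Q] ..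
  moreover have "A - X - (Y - X) = A - Y" if "X \<in> carrier_mat m n" "Y \<in> carrier_mat m n" for X Y
    using that A by (intro eq_matI) auto
  ultimately have 2: "A - P * A * Q - P * (A - A * Q) = A - P * A" using PA PAQ by simp
  have "(frobenius_norm (A - P * A * Q))\<^sup>2 = (frobenius_norm (A - P * A))\<^sup>2 + (frobenius_norm (P * (A - A * Q)))\<^sup>2"
    using frobenius_norm_projection[OF P minus_carrier_mat[OF PAQ], of A] unfolding 1 2 .
  moreover have "(frobenius_norm (P * (A - A * Q)))\<^sup>2 \<le> (frobenius_norm (A - A * Q))\<^sup>2"
    using frobenius_norm_projection[OF P minus_carrier_mat[OF AQ], of A] by simp
  ultimately show ?thesis by simp
qed

lemma select_cols_transpose:
  assumes "A \<in> carrier_mat m n" "set T \<subseteq> {..<m}"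
  shows "select_cols (transpose_mat A) T = transpose_mat (select_rows A T)"
proof -
  have "map (col (transpose_mat A)) T = map (row A) T" using assms by auto
  then show ?thesis
    by (simp only: select_cols_def select_rows_def transpose_mat_of_rows index_transpose_mat)
qed

theorem corollary2:
  fixes A C U R :: "real mat" and k m n :: nat and S T :: "nat list"
  assumes "A \<in> carrier_mat m n"
    and "1 \<le> k" and "k \<le> m" and "m \<le> n"
    and "vec_space.rank m A \<ge> k"
    and "css_output A k S"
    and "css_output (transpose_mat A) k T"
    and "C = select_cols A S"
    and "R = select_rows A T"
    and "U = moore_penrose C * A * moore_penrose R"
  shows "frobenius_norm (A - C * U * R)
           \<le> sqrt (2 * real k + 2) * sqrt (\<Sum>i = k + 1..m. (singular_value A i)\<^sup>2)"
proof -
  note A = assms(1)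
  have At: "transpose_mat A \<in> carrier_mat n m" using A by simp
  have pos: "coeff (gram_poly A) k > 0" using coeff_gram_poly_pos[OF A assms(5)] .
  have kn: "k \<le> n" using assms(3,4) by simp
  let ?tail = "\<Sum>i = k + 1..m. (singular_value A i)\<^sup>2"
  have tail: "coeff (gram_poly A) (Suc k) / coeff (gram_poly A) k \<le> ?tail"
    using coeff_gram_poly_Suc_le[OF A, of k] pos by (simp add: pos_divide_le_eq mult.commute)
  have bound: "real (Suc k) * (coeff (gram_poly A) (Suc k) / coeff (gram_poly A) k) \<le> real (Suc k) * ?tail"
    using tail by (rule mult_left_mono) simp
  have C: "C \<in> carrier_mat m (length S)" unfolding assms(8) by (rule select_cols_carrier[OF A])
  have posT: "coeff (gram_poly (transpose_mat A)) k > 0" using pos by (simp add: gram_poly_transpose[OF A])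
  note cols = css_output_bound(2)[OF A assms(3) pos assms(6)]
  note rows = css_output_bound[OF At kn posT assms(7)]
  have Rt: "select_cols (transpose_mat A) T = transpose_mat R"
    unfolding assms(9) by (rule select_cols_transpose[OF A rows(1)])
  have R: "R \<in> carrier_mat (length T) n"
    using select_cols_carrier[OF At, of T] unfolding Rt by simp
  let ?P = "C * moore_penrose C" and ?Q = "moore_penrose R * R"
  have mpC: "moore_penrose C \<in> carrier_mat (length S) m" and mpR: "moore_penrose R \<in> carrier_mat n (length T)"
    using moore_penrose_carrier C R by auto
  have P: "?P \<in> carrier_mat m m" "transpose_mat ?P = ?P" "?P * ?P = ?P"
    using range_projection[OF C] by simp_all
  have Q: "?Q \<in> carrier_mat n n" using mpR R by simp
  \<comment> \<open>The projection used for the transpose is the transpose of \<open>?Q\<close>, so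
    the residual of the row selection is the transpose of A - AQ.\<close>
  have "transpose_mat R * moore_penrose (transpose_mat R) = transpose_mat ?Q"
    using R mpR by (simp add: moore_penrose_transpose transpose_mult[of _ n "length T" _ n])
  then have "transpose_mat A - transpose_mat R * moore_penrose (transpose_mat R) * transpose_mat A = transpose_mat (A - A * ?Q)"
    using A Q by (simp add: transpose_minus[of _ m n] transpose_mult[of _ m n _ n])
  then have rowerr: "(frobenius_norm (A - A * ?Q))\<^sup>2 \<le> real (Suc k) * ?tail"
    using rows(2) bound unfolding Rt gram_poly_transpose[OF A] by (simp add: frobenius_norm_transpose)
  have colerr: "(frobenius_norm (A - ?P * A))\<^sup>2 \<le> real (Suc k) * ?tail"
    using cols bound unfolding assms(8) by simp
  \<comment> \<open>Regrouping shows \<open>A\<close> between two projections; each one-sided error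
    contributes k + 1 times the tail, which gives the factor 2k + 2.\<close>
  have "C * U * R = ?P * A * ?Q"
    unfolding assms(10) assoc_mult_mat[OF C mult_carrier_mat[OF mpC A] mpR, symmetric]
      assoc_mult_mat[OF C mpC A, symmetric]
    by (rule assoc_mult_mat[OF mult_carrier_mat[OF P(1) A] mpR R])
  then have "(frobenius_norm (A - C * U * R))\<^sup>2 \<le> (2 * real k + 2) * ?tail"
    using frobenius_norm_two_sided_projection_le[OF P Q A] rowerr colerr by (simp add: algebra_simps)
  then show ?thesis
    by (metis frobenius_norm_nonneg real_le_rsqrt real_sqrt_mult)
qed

end
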